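(* Let $X$ be a compact metric space of zero topological dimension. Let $T\colon X\to X$ be a homeomorphism with finitely many periodic points of any given period. Let $\mathbb{F}$ be either $\mathbb{C}$ or $\mathbb{R}$, and let $d\ge 2$. Additionally, assume that $d\ge 3$ if $\mathbb{F}=\mathbb{R}$ and $T$ has periodic points. Let $\mathcal{QC}$ be the set of $F\in C^0(X,\mathrm{GL}(d,\mathbb{F}))$ such that the linear cocycle $(T,F)$ admits quasiconformal orbits, that is, such that there exists $x\in X$ with $\sup_{n\in\mathbb{Z}}\kappa(F^{(n)}(x))<\infty$. Then the set $\mathcal{QC}$ is meager in $C^0(X,\mathrm{GL}(d,\mathbb{F}))$.
   Context: A topological space has zero topological dimension if every open cover can be refined to an open partition (for compact metric spaces, equivalently, the clopen sets form a basis of the topology). Given a homeomorphism $T\colon X\to X$ of a compact metric space and a continuous map $F\colon X\to\mathrm{GL}(d,\mathbb{F})$, the associated continuous linear cocycle $(T,F)$ is the unique continuous map $(x,n)\in X\times\mathbb{Z}\mapsto F^{(n)}(x)\in\mathrm{GL}(d,\mathbb{F})$ with $F^{(1)}=F$ and $F^{(m+n)}(x)=F^{(m)}(T^nx)F^{(n)}(x)$ for all $x\in X$ and $m,n\in\mathbb{Z}$. For a matrix $A\in\mathrm{GL}(d,\mathbb{F})$, $\|A\|$ is the Euclidean-induced operator norm and $\kappa(A):=\|A\|\,\|A^{-1}\|$ is the condition number. The space $C^0(X,\mathrm{GL}(d,\mathbb{F}))$ of continuous maps $X\to \mathrm{GL}(d,\mathbb{F})$ is endowed with the complete metric $d(F,G):=\sup_{x\in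 X}\left(\|F(x)-G(x)\|+\|F(x)^{-1}-G(x)^{-1}\|\right)$. A set is meager if it is a countable union of nowhere dense sets. *)

theory Defs
  imports "HOL-Analysis.Analysis"
begin

section \<open>Topological notions\<close>

definition zero_dimensional :: "'a topology \<Rightarrow> bool" where
  "zero_dimensional X \<longleftrightarrow>
     (\<forall>\<U>. (\<forall>U\<in>\<U>. openin X U) \<and> \<Union>\<U> = topspace X \<longrightarrow>
       (\<exists>\<P>. partition_on (topspace X) \<P> \<and> (\<forall>P\<in>\<P>. openin X P) \<and>
            (\<forall>P\<in>\<P>. \<exists>U\<in>\<U>. P \<subseteq> U)))"

definition nowhere_dense_in :: "'a topology \<Rightarrow> 'a set \<Rightarrow> bool" where
  "nowhere_dense_in X S \<longleftrightarrow> S \<subseteq> topspace X \<and> X interior_of (X closure_of S) = {}"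

definition meager_in :: "'a topology \<Rightarrow> 'a set \<Rightarrow> bool" where
  "meager_in X S \<longleftrightarrow> (\<exists>N :: nat \<Rightarrow> 'a set. (\<forall>n. nowhere_dense_in X (N n)) \<and> S = (\<Union>n. N n))"

section \<open>Matrices over a normed field\<close>

text \<open>The norm on \<open>'f^'n\<close> is the Euclidean (Hermitian, for complex scalars) norm, so for both
  scalar fields \<open>onorm\<close> yields the operator norm induced by the Euclidean norm.\<close>

definition mnorm :: "'f::real_normed_field^'n^'n \<Rightarrow> real" where
  "mnorm A = onorm (\<lambda>v. A *v v)"

definition cond_number :: "'f::real_normed_field^'n^'n \<Rightarrow> real" where
  "cond_number A = mnorm A * mnorm (matrix_inv A)"

section \<open>The space of continuous maps into the general linear group\<close>

definition C0_GL :: "('a::topological_space \<Rightarrow> 'f::real_normed_field^'n^'n) set" where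
  "C0_GL = {F. continuous_on UNIV F \<and> (\<forall>x. invertible (F x))}"

text \<open>The value outside \<open>C0_GL\<close> is irrelevant; it is fixed because \<open>Metric_space\<close> asks for
  nonnegativity and symmetry everywhere. See \<open>Metric_space_C0\<close> below.\<close>

definition C0_dist ::
  "('a::topological_space \<Rightarrow> 'f::real_normed_field^'n^'n) \<Rightarrow> ('a \<Rightarrow> 'f^'n^'n) \<Rightarrow> real" where
  "C0_dist F G =
     (if F \<in> C0_GL \<and> G \<in> C0_GL
      then SUP x. mnorm (F x - G x) + mnorm (matrix_inv (F x) - matrix_inv (G x)) else 0)"

definition C0_topology :: "('a::topological_space \<Rightarrow> 'f::real_normed_field^'n^'n) topology" where
  "C0_topology = Metric_space.mtopology C0_GL C0_dist"

section \<open>Cocycles\<close>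

definition int_iter :: "('a \<Rightarrow> 'a) \<Rightarrow> int \<Rightarrow> 'a \<Rightarrow> 'a" where
  "int_iter T n = (if 0 \<le> n then T ^^ nat n else inv T ^^ nat (- n))"

primrec cocycle_nat :: "('a \<Rightarrow> 'a) \<Rightarrow> ('a \<Rightarrow> 'f::real_normed_field^'n^'n) \<Rightarrow> nat \<Rightarrow> 'a \<Rightarrow> 'f^'n^'n" where
  "cocycle_nat T F 0 x = mat 1"
| "cocycle_nat T F (Suc n) x = F ((T ^^ n) x) ** cocycle_nat T F n x"

text \<open>\<open>cocycle T F n x\<close> is \<open>F\<^sup>(\<^sup>n\<^sup>)(x)\<close>. The defining properties of the cocycle
  (value at \<open>n = 1\<close>, cocycle identity, invertibility, continuity) and its uniqueness are
  \<open>is_cocycle_cocycle\<close> and \<open>is_cocycle_unique\<close> below.\<close>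

definition cocycle :: "('a \<Rightarrow> 'a) \<Rightarrow> ('a \<Rightarrow> 'f::real_normed_field^'n^'n) \<Rightarrow> int \<Rightarrow> 'a \<Rightarrow> 'f^'n^'n" where
  "cocycle T F n x =
     (if 0 \<le> n then cocycle_nat T F (nat n) x
      else matrix_inv (cocycle_nat T F (nat (- n)) (int_iter T n x)))"

definition is_cocycle ::
  "('a::topological_space \<Rightarrow> 'a) \<Rightarrow> ('a \<Rightarrow> 'f::real_normed_field^'n^'n) \<Rightarrow> (int \<Rightarrow> 'a \<Rightarrow> 'f^'n^'n) \<Rightarrow> bool" where
  "is_cocycle T F \<Phi> \<longleftrightarrow>
     (\<forall>n. \<Phi> n \<in> C0_GL) \<and> \<Phi> 1 = F \<and>
     (\<forall>m n x. \<Phi> (m + n) x = \<Phi> m (int_iter T n x) ** \<Phi> n x)"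

definition quasiconformal_orbits ::
  "('a::topological_space \<Rightarrow> 'a) \<Rightarrow> ('a \<Rightarrow> 'f::real_normed_field^'n^'n) set" where
  "quasiconformal_orbits T =
     {F \<in> C0_GL. \<exists>x. bdd_above (range (\<lambda>n::int. cond_number (cocycle T F n x)))}"

definition periodic_points :: "('a \<Rightarrow> 'a) \<Rightarrow> nat \<Rightarrow> 'a set" where
  "periodic_points T p = {x. (T ^^ p) x = x}"

section \<open>Consistency of the definitions\<close>

lemma matrix_inv_works:
  fixes A :: "'f::real_normed_field^'n^'n"
  assumes "invertible A"
  shows "A ** matrix_inv A = mat 1" "matrix_inv A ** A = mat 1"
proof -
  have "A ** matrix_inv A = mat 1 \<and> matrix_inv A ** A = mat 1"
    using assms unfolding invertible_def matrix_inv_def by (rule someI_ex)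
  then show "A ** matrix_inv A = mat 1" "matrix_inv A ** A = mat 1" by auto
qed

lemma invertible_matrix_inv:
  fixes A :: "'f::real_normed_field^'n^'n"
  shows "invertible A \<Longrightarrow> invertible (matrix_inv A)"
  using matrix_inv_works unfolding invertible_def by blast

lemma norm_mult_vec_le:
  fixes A :: "'f::real_normed_field^'n^'n"
  shows "norm (A *v v) \<le> (\<Sum>i\<in>UNIV. \<Sum>j\<in>UNIV. norm (A$i$j)) * norm v"
proof -
  have "norm (A *v v) \<le> (\<Sum>i\<in>UNIV. norm ((A *v v)$i))"
    unfolding norm_vec_def by (rule L2_set_le_sum) simp
  also have "\<dots> \<le> (\<Sum>i\<in>UNIV. \<Sum>j\<in>UNIV. norm (A$i$j) * norm v)"
  proof (rule sum_mono)
    fix i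
    have "norm ((A *v v)$i) \<le> (\<Sum>j\<in>UNIV. norm (A$i$j * v$j))"
      by (simp add: matrix_vector_mult_def norm_sum)
    also have "\<dots> \<le> (\<Sum>j\<in>UNIV. norm (A$i$j) * norm v)"
      by (intro sum_mono) (simp add: norm_mult mult_left_mono Finite_Cartesian_Product.norm_nth_le)
    finally show "norm ((A *v v)$i) \<le> (\<Sum>j\<in>UNIV. norm (A$i$j) * norm v)" .
  qed
  finally show ?thesis by (simp add: sum_distrib_right)
qed

lemma bounded_linear_mult_vec:
  fixes A :: "'f::real_normed_field^'n^'n"
  shows "bounded_linear (\<lambda>v. A *v v)"
proof (rule bounded_linear_intro)
  fix v w :: "'f^'n" and r :: real
  show "A *v (v + w) = A *v v + A *v w"
    by (simp add: matrix_vector_right_distrib)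
  show "A *v (r *\<^sub>R v) = r *\<^sub>R (A *v v)"
    by (simp add: vec_eq_iff matrix_vector_mult_def scaleR_sum_right)
  show "norm (A *v v) \<le> norm v * (\<Sum>i\<in>UNIV. \<Sum>j\<in>UNIV. norm (A$i$j))"
    using norm_mult_vec_le[of A v] by (simp add: mult.commute)
qed

lemma mnorm_le_entries:
  fixes A :: "'f::real_normed_field^'n^'n"
  shows "mnorm A \<le> (\<Sum>i\<in>UNIV. \<Sum>j\<in>UNIV. norm (A$i$j))"
  unfolding mnorm_def by (intro onorm_bound norm_mult_vec_le sum_nonneg) auto

lemma mnorm_nonneg: "0 \<le> mnorm (A :: 'f::real_normed_field^'n^'n)"
  unfolding mnorm_def by (rule onorm_pos_le[OF bounded_linear_mult_vec])

lemma mult_vec_axis: "(A *v axis j 1) $ i = (A :: 'f::real_normed_field^'n^'n) $ i $ j"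
proof -
  have "(\<Sum>k\<in>UNIV. A $ i $ k * axis j 1 $ k) = (\<Sum>k\<in>UNIV. if k = j then A $ i $ k else 0)"
    by (rule sum.cong) (auto simp: axis_def)
  then show ?thesis by (simp add: matrix_vector_mult_def)
qed

lemma mnorm_eq_0: "mnorm (A :: 'f::real_normed_field^'n^'n) = 0 \<longleftrightarrow> A = 0"
proof
  assume "mnorm A = 0"
  then have "A *v v = 0" for v
    unfolding mnorm_def using onorm_eq_0[OF bounded_linear_mult_vec, of A] by auto
  then have "A *v axis j 1 = 0" for j by blast
  then show "A = 0" by (simp add: vec_eq_iff mult_vec_axis)
next
  assume "A = 0"
  then show "mnorm A = 0" by (simp add: mnorm_def onorm_zero)
qed

lemma mnorm_triangle:
  "mnorm (A + B) \<le> mnorm A + mnorm (B :: 'f::real_normed_field^'n^'n)"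
  unfolding mnorm_def matrix_vector_mult_add_rdistrib
  by (rule onorm_triangle[OF bounded_linear_mult_vec bounded_linear_mult_vec])

lemma mnorm_minus: "mnorm (- A) = mnorm (A :: 'f::real_normed_field^'n^'n)"
proof -
  have "(- A) *v v = - (A *v v)" for v
    by (simp add: vec_eq_iff matrix_vector_mult_def sum_negf)
  then show ?thesis by (simp add: mnorm_def onorm_neg)
qed

lemma mnorm_diff_commute: "mnorm (A - B) = mnorm (B - A :: 'f::real_normed_field^'n^'n)"
  using mnorm_minus[of "A - B"] by simp

lemma continuous_on_det_field:
  fixes F :: "'a::topological_space \<Rightarrow> 'f::real_normed_field^'n^'n"
  assumes "\<And>i j. continuous_on S (\<lambda>x. F x $ i $ j)"
  shows "continuous_on S (\<lambda>x. det (F x))"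
  unfolding det_def by (intro continuous_intros assms)

lemma continuous_on_matrix_inv:
  fixes F :: "'a::topological_space \<Rightarrow> 'f::real_normed_field^'n^'n"
  assumes F: "continuous_on S F" and inv: "\<And>x. x \<in> S \<Longrightarrow> invertible (F x)"
  shows "continuous_on S (\<lambda>x. matrix_inv (F x))"
proof -
  have entry: "matrix_inv (F x) $ k $ j =
      det (\<chi> a b. if b = k then axis j 1 $ a else F x $ a $ b) / det (F x)"
    if x: "x \<in> S" for x k j
  proof -
    have d: "det (F x) \<noteq> 0" using inv[OF x] by (simp add: invertible_det_nz)
    have "F x *v (matrix_inv (F x) *v axis j 1) = axis j 1"
      by (simp add: matrix_vector_mul_assoc matrix_inv_works[OF inv[OF x]])
    then have "matrix_inv (F x) *v axis j 1 =
        (\<chi> k. det (\<chi> a b. if b = k then axis j 1 $ a else F x $ a $ b) / det (F x))"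
      using cramer[OF d] by blast
    then show ?thesis
      by (simp add: mult_vec_axis[symmetric])
  qed
  have c: "continuous_on S (\<lambda>x. F x $ a $ b)" for a b
    by (intro continuous_intros F)
  have "continuous_on S (\<lambda>x. matrix_inv (F x) $ k $ j)" for k j
  proof -
    have "continuous_on S (\<lambda>x. det (\<chi> a b. if b = k then axis j 1 $ a else F x $ a $ b) / det (F x))"
    proof (rule continuous_on_divide)
      show "continuous_on S (\<lambda>x. det (\<chi> a b. if b = k then axis j 1 $ a else F x $ a $ b))"
      proof (rule continuous_on_det_field)
        fix a b
        show "continuous_on S (\<lambda>x. (\<chi> a b. if b = k then axis j 1 $ a else F x $ a $ b) $ a $ b)"
          by (cases "b = k") (auto intro: c)
      qed
      show "continuous_on S (\<lambda>x. det (F x))" by (rule continuous_on_det_field[OF c])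
      show "\<forall>x\<in>S. det (F x) \<noteq> 0" using inv by (simp add: invertible_det_nz)
    qed
    then show ?thesis by (simp add: entry cong: continuous_on_cong)
  qed
  then have "continuous_on S (\<lambda>x. \<chi> k j. matrix_inv (F x) $ k $ j)"
    by (intro continuous_on_vec_lambda)
  then show ?thesis by simp
qed

lemma bdd_above_mnorm_diff:
  fixes F G :: "'a::topological_space \<Rightarrow> 'f::real_normed_field^'n^'n"
  assumes "compact (UNIV :: 'a set)" "continuous_on UNIV F" "continuous_on UNIV G"
  shows "bdd_above (range (\<lambda>x. mnorm (F x - G x)))"
proof -
  let ?g = "\<lambda>x. \<Sum>i\<in>UNIV. \<Sum>j\<in>UNIV. norm ((F x - G x)$i$j)"
  have "continuous_on UNIV ?g"
    by (intro continuous_intros assms)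
  then have "bdd_above (range ?g)"
    by (intro bounded_imp_bdd_above compact_imp_bounded compact_continuous_image assms(1))
  then obtain M where "\<And>x. ?g x \<le> M" by (auto simp: bdd_above_def)
  then show ?thesis
    using mnorm_le_entries order_trans by (intro bdd_aboveI2[where M = M]) blast
qed

lemma Metric_space_C0:
  assumes "compact (UNIV :: 'a::topological_space set)"
  shows "Metric_space (C0_GL :: ('a \<Rightarrow> 'f::real_normed_field^'n^'n) set) C0_dist"
proof
  let ?e = "\<lambda>F G (x::'a). mnorm (F x - G x) + mnorm (matrix_inv (F x) - matrix_inv (G x :: 'f^'n^'n))"
  have bdd: "bdd_above (range (?e F G))" if "F \<in> C0_GL" "G \<in> C0_GL" for F G
  proof -
    have "bdd_above (range (\<lambda>x. mnorm (F x - G x)))"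
      using that by (intro bdd_above_mnorm_diff assms) (auto simp: C0_GL_def)
    moreover have "bdd_above (range (\<lambda>x. mnorm (matrix_inv (F x) - matrix_inv (G x))))"
      using that by (intro bdd_above_mnorm_diff assms continuous_on_matrix_inv) (auto simp: C0_GL_def)
    ultimately obtain M N where "\<And>x. mnorm (F x - G x) \<le> M"
      "\<And>x. mnorm (matrix_inv (F x) - matrix_inv (G x)) \<le> N"
      by (auto simp: bdd_above_def)
    then show ?thesis by (intro bdd_aboveI2[where M = "M + N"] add_mono)
  qed
  have up: "?e F G x \<le> C0_dist F G" if "F \<in> C0_GL" "G \<in> C0_GL" for F G x
    using that bdd[OF that] by (auto simp: C0_dist_def intro!: cSUP_upper2)
  have zero: "C0_dist F F = 0" for F :: "'a \<Rightarrow> 'f^'n^'n"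
    by (simp add: C0_dist_def mnorm_eq_0)
  show "0 \<le> C0_dist F G" for F G :: "'a \<Rightarrow> 'f^'n^'n"
  proof (cases "F \<in> C0_GL \<and> G \<in> C0_GL")
    case True
    then have "?e F G undefined \<le> C0_dist F G" using up by blast
    then show ?thesis
      using mnorm_nonneg[of "F undefined - G undefined"]
        mnorm_nonneg[of "matrix_inv (F undefined) - matrix_inv (G undefined)"] by linarith
  qed (auto simp: C0_dist_def)
  show "C0_dist F G = C0_dist G F" for F G :: "'a \<Rightarrow> 'f^'n^'n"
    unfolding C0_dist_def by (subst (1 2) mnorm_diff_commute) auto
  show "C0_dist F G = 0 \<longleftrightarrow> F = G" if "F \<in> C0_GL" "G \<in> C0_GL" for F G :: "'a \<Rightarrow> 'f^'n^'n"
  proof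
    assume "C0_dist F G = 0"
    then have "mnorm (F x - G x) = 0" for x
      using up[OF that, of x] mnorm_nonneg[of "F x - G x"]
        mnorm_nonneg[of "matrix_inv (F x) - matrix_inv (G x)"] by linarith
    then show "F = G" by (auto simp: mnorm_eq_0)
  qed (simp add: zero)
  show "C0_dist F H \<le> C0_dist F G + C0_dist G H"
    if "F \<in> C0_GL" "G \<in> C0_GL" "H \<in> C0_GL" for F G H :: "'a \<Rightarrow> 'f^'n^'n"
  proof -
    have "?e F H x \<le> C0_dist F G + C0_dist G H" for x
    proof -
      have "?e F H x \<le> ?e F G x + ?e G H x"
        using mnorm_triangle[of "F x - G x" "G x - H x"]
          mnorm_triangle[of "matrix_inv (F x) - matrix_inv (G x)" "matrix_inv (G x) - matrix_inv (H x)"]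
        by simp
      also have "\<dots> \<le> C0_dist F G + C0_dist G H"
        using up that by (intro add_mono) blast+
      finally show ?thesis .
    qed
    then show ?thesis using that unfolding C0_dist_def[of F H] by (auto intro!: cSUP_least)
  qed
qed

lemma int_iter_0: "int_iter T 0 x = x"
  by (simp add: int_iter_def)

lemma int_iter_Suc:
  assumes "bij T"
  shows "int_iter T (n + 1) x = T (int_iter T n x)"
proof (cases "0 \<le> n")
  case True
  then show ?thesis by (simp add: int_iter_def nat_add_distrib)
next
  case False
  then obtain k where k: "n = - int (Suc k)"
    by (metis not_le negD)
  have "int_iter T (n + 1) x = (inv T ^^ k) x"
    unfolding k by (cases k) (auto simp: int_iter_def nat_add_distrib)
  moreover have "T (int_iter T n x) = (inv T ^^ k) x"
    unfolding k using assms by (simp add: int_iter_def nat_add_distrib bij_is_surj surj_f_inv_f)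
  ultimately show ?thesis by simp
qed

lemma int_iter_diff:
  assumes "bij T"
  shows "T (int_iter T (n - 1) x) = int_iter T n x"
  using int_iter_Suc[OF assms, of "n - 1" x] by simp

lemma int_iter_add:
  assumes "bij T"
  shows "int_iter T (m + n) x = int_iter T m (int_iter T n x)"
proof (induction m rule: int_induct[where k = 0])
  case base
  then show ?case by (simp add: int_iter_0)
next
  case (step1 i)
  then show ?case
    using int_iter_Suc[OF assms, of "i + n" x] int_iter_Suc[OF assms, of i "int_iter T n x"]
    by (simp add: algebra_simps)
next
  case (step2 i)
  have "T (int_iter T (i - 1 + n) x) = T (int_iter T (i - 1) (int_iter T n x))"
    using step2 int_iter_diff[OF assms, of "i + n" x] int_iter_diff[OF assms, of i "int_iter T n x"]
    by (simp add: algebra_simps)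
  then show ?case using assms by (meson bij_is_inj injD)
qed

lemma matrix_inv_unique_right:
  fixes A B :: "'f::real_normed_field^'n^'n"
  assumes "invertible A" "A ** B = mat 1"
  shows "matrix_inv A = B"
proof -
  have "matrix_inv A ** (A ** B) = B"
    by (simp add: matrix_mul_assoc matrix_inv_works[OF assms(1)])
  then show ?thesis by (simp add: assms(2))
qed

lemma invertible_mult_field:
  fixes A B :: "'f::real_normed_field^'n^'n"
  shows "invertible A \<Longrightarrow> invertible B \<Longrightarrow> invertible (A ** B)"
  by (simp add: invertible_det_nz det_mul)

lemma invertible_mult_cancel_left:
  fixes A B C :: "'f::real_normed_field^'n^'n"
  assumes "invertible A" "A ** B = A ** C"
  shows "B = C"
proof -
  have "matrix_inv A ** (A ** B) = matrix_inv A ** (A ** C)" using assms by simp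
  then show ?thesis by (simp add: matrix_mul_assoc matrix_inv_works[OF assms(1)])
qed

lemma cocycle_nat_Suc_right:
  "cocycle_nat T F (Suc n) x = cocycle_nat T F n (T x) ** F x"
proof (induction n)
  case (Suc n)
  have "cocycle_nat T F (Suc (Suc n)) x = F ((T ^^ Suc n) x) ** cocycle_nat T F (Suc n) x"
    by simp
  also have "\<dots> = F ((T ^^ n) (T x)) ** (cocycle_nat T F n (T x) ** F x)"
    by (simp only: Suc funpow_Suc_right comp_def)
  finally show ?case by (simp add: matrix_mul_assoc)
qed simp

lemma cocycle_0: "cocycle T F 0 x = mat 1"
  by (simp add: cocycle_def)

lemma invertible_cocycle_nat:
  assumes "\<And>x. invertible (F x)"
  shows "invertible (cocycle_nat T F n x)"
proof (induction n)
  case 0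
  show ?case by (simp add: invertible_det_nz)
qed (simp add: invertible_mult_field assms)

lemma invertible_cocycle:
  assumes "\<And>x. invertible (F x)"
  shows "invertible (cocycle T F n x)"
  by (simp add: cocycle_def invertible_cocycle_nat invertible_matrix_inv assms)

lemma cocycle_Suc:
  assumes T: "bij T" and F: "\<And>x. invertible (F x)"
  shows "cocycle T F (n + 1) x = F (int_iter T n x) ** cocycle T F n x"
proof (cases "0 \<le> n")
  case True
  then show ?thesis by (simp add: cocycle_def int_iter_def nat_add_distrib)
next
  case False
  then obtain k where k: "n = - int (Suc k)"
    by (metis not_le negD)
  define y where "y = int_iter T n x"
  have Ty: "int_iter T (n + 1) x = T y"
    by (simp add: y_def int_iter_Suc[OF T])
  let ?C = "cocycle_nat T F k (T y)"
  have C: "invertible ?C" by (rule invertible_cocycle_nat[OF F])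
  have 1: "cocycle T F n x = matrix_inv (?C ** F y)"
    unfolding cocycle_def y_def[symmetric] cocycle_nat_Suc_right[symmetric] by (simp add: k nat_add_distrib del: cocycle_nat.simps)
  have 2: "cocycle T F (n + 1) x = matrix_inv ?C"
  proof (cases k)
    case 0
    then have "n + 1 = 0" by (simp add: k)
    moreover have "matrix_inv (mat 1 :: 'b^'c^'c) = mat 1"
      by (rule matrix_inv_unique_right) (simp_all add: invertible_det_nz)
    ultimately show ?thesis by (simp add: cocycle_0 0)
  next
    case (Suc m)
    then have "\<not> 0 \<le> n + 1" "nat (- (n + 1)) = k" by (auto simp: k)
    then show ?thesis unfolding cocycle_def Ty by simp
  qed
  have "?C ** (F y ** matrix_inv (?C ** F y)) = mat 1"
    by (simp add: matrix_mul_assoc matrix_inv_works[OF invertible_mult_field[OF C F]])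
  then have "matrix_inv ?C = F y ** matrix_inv (?C ** F y)"
    by (rule matrix_inv_unique_right[OF C])
  then show ?thesis by (simp add: 1 2 y_def)
qed

lemma cocycle_add:
  assumes T: "bij T" and F: "\<And>x. invertible (F x)"
  shows "cocycle T F (m + n) x = cocycle T F m (int_iter T n x) ** cocycle T F n x"
proof (induction m rule: int_induct[where k = 0])
  case base
  then show ?case by (simp add: cocycle_0)
next
  case (step1 i)
  have "cocycle T F (i + n + 1) x = F (int_iter T (i + n) x) ** cocycle T F (i + n) x"
    by (rule cocycle_Suc[OF T F])
  also have "\<dots> = F (int_iter T i (int_iter T n x)) ** cocycle T F i (int_iter T n x) ** cocycle T F n x"
    using step1 by (simp add: int_iter_add[OF T] matrix_mul_assoc)
  also have "\<dots> = cocycle T F (i + 1) (int_iter T n x) ** cocycle T F n x"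
    by (simp add: cocycle_Suc[OF T F])
  finally show ?case by (simp add: algebra_simps)
next
  case (step2 i)
  let ?y = "int_iter T n x"
  let ?A = "F (int_iter T (i - 1) ?y)"
  have "?A ** cocycle T F (i - 1 + n) x = cocycle T F (i + n) x"
    using cocycle_Suc[where T = T and F = F and n = "i - 1 + n" and x = x, OF T F]
      int_iter_add[OF T, of "i - 1" n x] by (simp add: algebra_simps)
  also have "\<dots> = cocycle T F i ?y ** cocycle T F n x"
    by (rule step2.IH)
  also have "cocycle T F i ?y = ?A ** cocycle T F (i - 1) ?y"
    using cocycle_Suc[where T = T and F = F and n = "i - 1" and x = "?y", OF T F] by (simp add: F)
  finally have "?A ** cocycle T F (i - 1 + n) x = ?A ** (cocycle T F (i - 1) ?y ** cocycle T F n x)"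
    by (simp add: matrix_mul_assoc)
  then show ?case by (rule invertible_mult_cancel_left[OF F])
qed

lemma continuous_on_matrix_mult:
  fixes F G :: "'a::topological_space \<Rightarrow> 'f::real_normed_field^'n^'n"
  assumes "continuous_on S F" "continuous_on S G"
  shows "continuous_on S (\<lambda>x. F x ** G x)"
  unfolding matrix_matrix_mult_def
  by (intro continuous_on_vec_lambda continuous_intros assms)

lemma continuous_on_funpow:
  fixes T :: "'a::topological_space \<Rightarrow> 'a"
  assumes "continuous_on UNIV T"
  shows "continuous_on UNIV (T ^^ n)"
proof (induction n)
  case (Suc n)
  then show ?case
    using assms by (simp add: comp_def) (metis continuous_on_compose2 subset_UNIV)
qed (simp add: id_def)

lemma continuous_on_cocycle_nat:
  fixes T :: "'a::topological_space \<Rightarrow> 'a"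
  assumes "continuous_on UNIV T" "continuous_on UNIV F"
  shows "continuous_on UNIV (cocycle_nat T F n)"
proof (induction n)
  case 0
  show ?case by simp
next
  case (Suc n)
  have "continuous_on UNIV (\<lambda>x. F ((T ^^ n) x))"
    by (rule continuous_on_compose2[OF assms(2) continuous_on_funpow[OF assms(1)]]) auto
  from continuous_on_matrix_mult[OF this Suc] show ?case by simp
qed

lemma is_cocycle_cocycle:
  fixes T :: "'a::topological_space \<Rightarrow> 'a"
  assumes hom: "homeomorphism UNIV UNIV T (inv T)" and F: "F \<in> C0_GL"
  shows "is_cocycle T F (cocycle T F)"
proof -
  have T: "continuous_on UNIV T" "continuous_on UNIV (inv T)"
    using hom by (auto simp: homeomorphism_def)
  have bij: "bij T"
    using hom by (metis UNIV_I homeomorphism_def bijI')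
  have inv: "\<And>x. invertible (F x)" and F': "continuous_on UNIV F"
    using F by (auto simp: C0_GL_def)
  have "continuous_on UNIV (cocycle T F n)" for n
  proof (cases "0 \<le> n")
    case True
    then have "cocycle T F n = cocycle_nat T F (nat n)" by (auto simp: cocycle_def)
    then show ?thesis by (simp add: continuous_on_cocycle_nat T F')
  next
    case False
    then have "cocycle T F n = (\<lambda>x. matrix_inv (cocycle_nat T F (nat (- n)) ((inv T ^^ nat (- n)) x)))"
      by (auto simp: cocycle_def int_iter_def)
    moreover have "continuous_on UNIV (\<lambda>x. cocycle_nat T F (nat (- n)) ((inv T ^^ nat (- n)) x))"
      by (rule continuous_on_compose2[OF continuous_on_cocycle_nat[OF T(1) F']
            continuous_on_funpow[OF T(2)]]) auto
    ultimately show ?thesis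
      by (simp add: continuous_on_matrix_inv invertible_cocycle_nat inv)
  qed
  moreover have "cocycle T F 1 = F"
    by (auto simp: cocycle_def)
  ultimately show ?thesis
    by (simp add: is_cocycle_def C0_GL_def invertible_cocycle inv cocycle_add[OF bij])
qed

lemma is_cocycle_unique:
  assumes \<Phi>: "is_cocycle T F \<Phi>" and \<Psi>: "is_cocycle T F \<Psi>" and bij: "bij T"
  shows "\<Phi> = \<Psi>"
proof -
  have inv: "invertible (F x)" for x
    using \<Phi> by (auto simp: is_cocycle_def C0_GL_def)
  have zero: "\<Theta> 0 x = mat 1" if "is_cocycle T F \<Theta>" for \<Theta> x
  proof -
    have "\<Theta> 0 x ** \<Theta> 0 x = \<Theta> 0 x ** mat 1"
      using that unfolding is_cocycle_def by (metis add_0 int_iter_0 matrix_mul_rid)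
    moreover have "invertible (\<Theta> 0 x)" using that by (auto simp: is_cocycle_def C0_GL_def)
    ultimately show ?thesis by (metis invertible_mult_cancel_left)
  qed
  have step: "\<Theta> (n + 1) x = F (int_iter T n x) ** \<Theta> n x" if "is_cocycle T F \<Theta>" for \<Theta> n x
    using that unfolding is_cocycle_def by (metis add.commute)
  have "\<Phi> n x = \<Psi> n x" for n x
  proof (induction n rule: int_induct[where k = 0])
    case base
    show ?case by (simp add: zero[OF \<Phi>] zero[OF \<Psi>])
  next
    case (step1 i)
    then show ?case using step[OF \<Phi>] step[OF \<Psi>] by simp
  next
    case (step2 i)
    then show ?case
      using step[OF \<Phi>, of "i - 1" x] step[OF \<Psi>, of "i - 1" x]
        invertible_mult_cancel_left[OF inv] by simp
  qed
  then show ?thesis by blast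
qed

end

theory Submission
  imports Defs "HOL-Computational_Algebra.Fundamental_Theorem_Algebra"
begin

text \<open>
  Call an orbit bounded by \<open>C\<close> if all products of the cocycle along finite pieces of it have condition
  number at most \<open>C\<close>. A quasiconformal orbit is bounded by some natural number
  (\<open>cond_number_cocycle_shift\<close>), so it suffices that for every \<open>C > 0\<close> the cocycles none of whose orbits
  is bounded by \<open>C\<close> contain a dense open set. Openness is a compactness argument
  (\<open>stable_all_orbits_exceed\<close>); the content is density (\<open>all_orbits_exceed_dense\<close>).

  The mechanism is this. Suppose the condition numbers of \<open>F\<^sup>(\<^sup>j\<^sup>)(x)\<close> stay below \<open>2C\<close> for \<open>j \<le> N\<close>. Fix a
  rank-one coordinate projection \<open>E\<close> and \<open>\<delta> > 0\<close>, and replace \<open>F(T\<^sup>jx)\<close> by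
  \<open>F(T\<^sup>jx) (1 + \<delta> A\<^sub>j E A\<^sub>j\<^sup>-\<^sup>1)\<close> with \<open>A\<^sub>j = F\<^sup>(\<^sup>j\<^sup>)(x)\<close>. The bound on the condition numbers makes
  this a perturbation of size \<open>O(\<delta>)\<close>, uniformly in \<open>N\<close>, and the new product over \<open>N\<close> steps is
  \<open>A\<^sub>N (1 + \<delta>E)\<^sup>N\<close>, whose condition number is at least \<open>(1 + \<delta>)\<^sup>N / 2C\<close>. This exceeds \<open>C\<close> when \<open>N\<close> is
  large (\<open>stretch_along_tower\<close>).

  To do this at all points simultaneously one needs a clopen set \<open>U\<close> whose iterates \<open>U, TU, \<dots>, T\<^sup>N\<^sup>-\<^sup>1U\<close> are
  disjoint and which meets every orbit; zero-dimensionality provides it by a greedy construction away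
  from the points of period less than \<open>N\<close> (\<open>ex_tower_base\<close>). Those finitely many periodic points are
  treated beforehand: a small perturbation makes the powers of the return matrix unbounded in
  condition number (\<open>exceed_at_finitely_many_periodic_points\<close>). By continuity some product over at
  most \<open>M\<close> steps then has condition number above \<open>C\<close> on a whole clopen neighbourhood \<open>V\<close>. One can choose \<open>V\<close>
  to contain also every point at which a product over at most \<open>M\<close> steps reaches \<open>2C\<close>. The towers are built so as to
  avoid \<open>V\<close> and its first \<open>M\<close> images. Thus an orbit that enters \<open>V\<close> still exceeds \<open>C\<close> after the towers have been
  stretched, an orbit that does not enter \<open>V\<close> meets \<open>U\<close>, and the bound \<open>2C\<close> holds on \<open>U\<close>.

  The restriction on the dimension comes from the periodic points. Let \<open>v\<close> be a complex
  eigenvector of the return matrix \<open>A\<close>, with eigenvalue \<open>c\<close>. If the powers of \<open>A\<close> have bounded condition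
  number then \<open>\<bar>c\<bar>\<^sup>d = \<bar>det A\<bar>\<close> (\<open>unbounded_powers_eigenvector\<close>). Perturbing \<open>A\<close> by a factor that fixes \<open>v\<close>
  and has determinant \<open>1 + \<delta>\<close> destroys this equality. Such a factor is \<open>1 + \<delta> e\<^sub>i \<phi>\<close> with a row vector \<open>\<phi>\<close>
  that annihilates \<open>v\<close>: over the complex numbers this asks for \<open>d \<ge> 2\<close>, over the reals \<open>\<phi>\<close>
  has to annihilate the real and the imaginary part of \<open>v\<close>, whence \<open>d \<ge> 3\<close>. In real dimension two a
  matrix with non-real eigenvalues is conjugate to a similarity, and so are its small perturbations.
\<close>

section \<open>Operator norms and condition numbers\<close>

lemma norm_mult_vec_le_mnorm:
  fixes A :: "'f::real_normed_field^'n^'n"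
  shows "norm (A *v v) \<le> mnorm A * norm v"
  unfolding mnorm_def by (rule onorm[OF bounded_linear_mult_vec])

lemma mnorm_mult:
  fixes A B :: "'f::real_normed_field^'n^'n"
  shows "mnorm (A ** B) \<le> mnorm A * mnorm B"
  using onorm_compose[OF bounded_linear_mult_vec bounded_linear_mult_vec, of A B]
  by (simp add: mnorm_def o_def matrix_vector_mul_assoc)

lemma mnorm_mult_mono:
  fixes A B :: "'f::real_normed_field^'n^'n"
  assumes "mnorm A \<le> a" "mnorm B \<le> b"
  shows "mnorm (A ** B) \<le> a * b"
  using mnorm_mult[of A B] mult_mono[OF assms] mnorm_nonneg[of A] mnorm_nonneg[of B] assms
  by linarith

lemma scaleR_mult_vec:
  fixes A :: "'f::real_normed_field^'n^'n"
  shows "(r *\<^sub>R A) *v v = r *\<^sub>R (A *v v)"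
  by (simp add: vec_eq_iff matrix_vector_mult_def scaleR_sum_right)

lemma mnorm_scaleR:
  fixes A :: "'f::real_normed_field^'n^'n"
  shows "mnorm (r *\<^sub>R A) = \<bar>r\<bar> * mnorm A"
  unfolding mnorm_def scaleR_mult_vec by (rule onorm_scaleR[OF bounded_linear_mult_vec])

lemma norm_axis_field: "norm (axis j (1::'f::real_normed_field) :: 'f^'n) = 1"
proof -
  have "(\<Sum>i\<in>UNIV. (norm ((axis j 1 :: 'f^'n) $ i))\<^sup>2) = (\<Sum>i\<in>UNIV. if i = j then 1 else 0)"
    by (intro sum.cong) (auto simp: axis_def)
  then show ?thesis by (simp add: norm_vec_def L2_set_def)
qed

lemma norm_entry_le_mnorm:
  fixes A :: "'f::real_normed_field^'n^'n"
  shows "norm (A $ i $ j) \<le> mnorm A"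
proof -
  have "norm (A $ i $ j) \<le> norm (A *v axis j 1)"
    using Finite_Cartesian_Product.norm_nth_le[of "A *v axis j 1" i] by (simp add: mult_vec_axis)
  also have "\<dots> \<le> mnorm A"
    using norm_mult_vec_le_mnorm[of A "axis j 1"] by (simp add: norm_axis_field)
  finally show ?thesis .
qed

lemma matrix_inv_mult:
  fixes A B :: "'f::real_normed_field^'n^'n"
  assumes "invertible A" "invertible B"
  shows "matrix_inv (A ** B) = matrix_inv B ** matrix_inv A"
proof (rule matrix_inv_unique_right[OF invertible_mult_field[OF assms]])
  have "(A ** B) ** (matrix_inv B ** matrix_inv A) = A ** (B ** matrix_inv B) ** matrix_inv A"
    by (simp only: matrix_mul_assoc)
  then show "(A ** B) ** (matrix_inv B ** matrix_inv A) = mat 1"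
    by (simp add: matrix_inv_works assms)
qed

lemma matrix_inv_matrix_inv:
  fixes A :: "'f::real_normed_field^'n^'n"
  assumes "invertible A"
  shows "matrix_inv (matrix_inv A) = A"
  by (rule matrix_inv_unique_right) (simp_all add: invertible_matrix_inv matrix_inv_works assms)

lemma cond_number_mult:
  fixes A B :: "'f::real_normed_field^'n^'n"
  assumes "invertible A" "invertible B"
  shows "cond_number (A ** B) \<le> cond_number A * cond_number B"
proof -
  have "cond_number (A ** B) \<le> (mnorm A * mnorm B) * (mnorm (matrix_inv B) * mnorm (matrix_inv A))"
    unfolding cond_number_def matrix_inv_mult[OF assms]
    by (intro mult_mono mnorm_mult mult_nonneg_nonneg mnorm_nonneg)
  then show ?thesis by (simp add: cond_number_def mult_ac)
qed

lemma cond_number_matrix_inv: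
  fixes A :: "'f::real_normed_field^'n^'n"
  shows "invertible A \<Longrightarrow> cond_number (matrix_inv A) = cond_number A"
  by (simp add: cond_number_def matrix_inv_matrix_inv)

lemma cond_number_nonneg: "0 \<le> cond_number (A :: 'f::real_normed_field^'n^'n)"
  by (simp add: cond_number_def mnorm_nonneg)

text \<open>
  The form in which lower bounds on the condition number are obtained: it compares how much \<open>A\<close>
  stretches two given directions.
\<close>

lemma cond_number_ge_ratio:
  fixes A :: "'f::real_normed_field^'n^'n"
  assumes "invertible A"
  shows "norm (A *v v) * norm w \<le> cond_number A * (norm v * norm (A *v w))"
proof -
  have "norm w = norm (matrix_inv A *v (A *v w))"
    by (simp add: matrix_vector_mul_assoc matrix_inv_works assms)
  also have "\<dots> \<le> mnorm (matrix_inv A) * norm (A *v w)" by (rule norm_mult_vec_le_mnorm)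
  finally have "norm (A *v v) * norm w \<le> (mnorm A * norm v) * (mnorm (matrix_inv A) * norm (A *v w))"
    by (intro mult_mono norm_mult_vec_le_mnorm mult_nonneg_nonneg mnorm_nonneg) auto
  then show ?thesis by (simp add: cond_number_def mult_ac)
qed

text \<open>
  Hadamard's inequality would give the constant 1. Since only exponential growth rates are compared
  below, the count of terms in the Leibniz formula is good enough.
\<close>

lemma norm_det_le:
  fixes A :: "'f::real_normed_field^'n^'n"
  shows "norm (det A) \<le> fact CARD('n) * mnorm A ^ CARD('n)"
proof -
  have "norm (det A) \<le> (\<Sum>p | p permutes (UNIV::'n set). mnorm A ^ CARD('n))"
    unfolding det_def
  proof (rule sum_norm_le)
    fix p :: "'n \<Rightarrow> 'n"
    have "norm (of_int (sign p) :: 'f) = 1" by (simp add: sign_def)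
    moreover have "norm (\<Prod>i\<in>UNIV. A $ i $ p i) \<le> (\<Prod>i\<in>(UNIV::'n set). mnorm A)"
      unfolding prod_norm[symmetric] by (intro prod_mono) (simp add: norm_entry_le_mnorm)
    ultimately show "norm (of_int (sign p) * (\<Prod>i\<in>UNIV. A $ i $ p i)) \<le> mnorm A ^ CARD('n)"
      by (simp add: norm_mult)
  qed
  also have "\<dots> = fact CARD('n) * mnorm A ^ CARD('n)"
    by (simp add: card_permutations)
  finally show ?thesis .
qed

section \<open>Powers of a matrix with unbounded condition number\<close>

primrec matrix_power :: "'f::real_normed_field^'n^'n \<Rightarrow> nat \<Rightarrow> 'f^'n^'n" where
  "matrix_power A 0 = mat 1"
| "matrix_power A (Suc n) = A ** matrix_power A n"

definition unbounded_powers :: "'f::real_normed_field^'n^'n \<Rightarrow> bool" where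
  "unbounded_powers A \<longleftrightarrow> (\<forall>C. \<exists>n. C < cond_number (matrix_power A n))"

lemma invertible_mat1: "invertible (mat 1 :: 'f::real_normed_field^'n^'n)"
  by (simp add: invertible_det_nz)

lemma invertible_matrix_power:
  "invertible A \<Longrightarrow> invertible (matrix_power A n)"
  by (induction n) (simp_all add: invertible_mat1 invertible_mult_field)

lemma det_matrix_power: "det (matrix_power A n) = det A ^ n"
  by (induction n) (simp_all add: det_mul)

lemma matrix_power_eigenvector:
  "A *v v = c *s v \<Longrightarrow> matrix_power A n *v v = c ^ n *s v"
  by (induction n)
    (simp_all add: matrix_vector_mul_assoc[symmetric] vec.scale vector_smult_assoc mult.commute)

lemma le_one_if_powers_bounded:
  fixes x :: real
  assumes "\<And>n. x ^ n \<le> K"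
  shows "x \<le> 1"
  using real_arch_pow[of x K] assms by (meson not_le)

text \<open>
  If the powers \<open>A\<^sup>n\<close> had condition number at most \<open>C\<close>, the factor by which \<open>A\<^sup>n\<close> stretches any vector, hence
  \<open>\<bar>c\<bar>\<^sup>n\<close>, would agree with \<open>\<bar>det A\<bar>\<^sup>n\<^sup>/\<^sup>d\<close> up to a factor independent of \<open>n\<close>. Two geometric
  sequences with bounded quotients have equal ratios.
\<close>

lemma unbounded_powers_eigenvector:
  fixes A :: "complex^'n^'n"
  assumes A: "invertible A" and v: "v \<noteq> 0" "A *v v = c *s v"
    and ne: "norm c ^ CARD('n) \<noteq> norm (det A)"
  shows "unbounded_powers A"
proof (rule ccontr)
  assume "\<not> unbounded_powers A"
  then obtain C where C: "\<And>n. cond_number (matrix_power A n) \<le> C"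
    unfolding unbounded_powers_def by (auto simp: not_less)
  let ?d = "CARD('n)"
  define K where "K = fact ?d * C ^ ?d"
  define D where "D = norm (det A)"
  define R where "R = norm c ^ ?d"
  have "c \<noteq> 0"
  proof
    assume "c = 0"
    then have "matrix_inv A *v (A *v v) = 0" by (simp add: v)
    then show False using v(1) by (simp add: matrix_vector_mul_assoc matrix_inv_works A)
  qed
  then have R: "R > 0" by (simp add: R_def)
  have D: "D > 0" using A by (simp add: D_def invertible_det_nz)
  have bounds: "D ^ n \<le> K * R ^ n" "R ^ n \<le> K * D ^ n" for n
  proof -
    let ?M = "matrix_power A n"
    define m m' where "m = mnorm ?M" and "m' = mnorm (matrix_inv ?M)"
    have M: "invertible ?M" by (rule invertible_matrix_power[OF A])
    have nn: "0 \<le> m" "0 \<le> m'" by (simp_all add: m_def m'_def mnorm_nonneg)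
    have mm: "m * m' \<le> C" using C[of n] by (simp add: m_def m'_def cond_number_def)
    have norm_Mv: "norm (?M *v v) = norm c ^ n * norm v"
      by (simp add: matrix_power_eigenvector[OF v(2)] norm_vec_def norm_mult norm_power
          L2_set_right_distrib flip: L2_set_def)
    have r: "norm c ^ n \<le> m"
      using norm_mult_vec_le_mnorm[of ?M v] v(1) unfolding norm_Mv m_def[symmetric] by simp
    have "norm v = norm (matrix_inv ?M *v (?M *v v))"
      by (simp add: matrix_vector_mul_assoc matrix_inv_works M)
    also have "\<dots> \<le> m' * (norm c ^ n * norm v)"
      using norm_mult_vec_le_mnorm[of "matrix_inv ?M" "?M *v v"] by (simp only: norm_Mv m'_def)
    finally have r': "1 \<le> m' * norm c ^ n" using v(1) by simp
    have Rn: "R ^ n = (norm c ^ n) ^ ?d"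
      by (simp add: R_def mult.commute flip: power_mult)
    have dM: "norm (det ?M) = D ^ n" by (simp add: det_matrix_power norm_power D_def)
    have "norm (det (matrix_inv ?M)) * norm (det ?M) = norm (det (matrix_inv ?M ** ?M))"
      by (simp only: det_mul norm_mult)
    then have dM': "norm (det (matrix_inv ?M)) * D ^ n = 1"
      by (simp add: matrix_inv_works M dM)
    have "m \<le> m * (m' * norm c ^ n)" using mult_left_mono[OF r' nn(1)] by simp
    also have "\<dots> \<le> C * norm c ^ n"
      using mult_right_mono[OF mm, of "norm c ^ n"] by (simp add: mult_ac)
    finally have "m ^ ?d \<le> C ^ ?d * R ^ n"
      unfolding Rn power_mult_distrib[symmetric] using nn by (intro power_mono)
    then have "fact ?d * m ^ ?d \<le> K * R ^ n" by (simp add: K_def mult_ac)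
    moreover have "D ^ n \<le> fact ?d * m ^ ?d" using norm_det_le[of ?M] by (simp add: dM m_def)
    ultimately show "D ^ n \<le> K * R ^ n" by linarith
    have "1 \<le> fact ?d * m' ^ ?d * D ^ n"
      using mult_right_mono[OF norm_det_le[of "matrix_inv ?M"], of "D ^ n"] D
      by (simp add: dM' m'_def)
    then have "m ^ ?d * 1 \<le> m ^ ?d * (fact ?d * m' ^ ?d * D ^ n)"
      using nn by (intro mult_left_mono) auto
    also have "\<dots> = fact ?d * (m * m') ^ ?d * D ^ n" by (simp add: power_mult_distrib)
    also have "\<dots> \<le> K * D ^ n"
      unfolding K_def using mm nn D by (intro mult_right_mono mult_left_mono power_mono) auto
    finally show "R ^ n \<le> K * D ^ n"
      using power_mono[OF r, of ?d] unfolding Rn by simp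
  qed
  have "D / R \<le> 1"
    by (rule le_one_if_powers_bounded[of _ K]) (use bounds(1) R in \<open>simp add: power_divide divide_le_eq\<close>)
  moreover have "R / D \<le> 1"
    by (rule le_one_if_powers_bounded[of _ K]) (use bounds(2) D in \<open>simp add: power_divide divide_le_eq\<close>)
  ultimately have "D \<le> R" "R \<le> D" using R D by (simp_all add: divide_le_eq)
  then show False using ne unfolding R_def D_def by linarith
qed

section \<open>Eigenvectors and making powers unbounded\<close>

lemma poly_det: "poly (det B) z = det (\<chi> i j. poly (B $ i $ j) z)"
  for B :: "'f::comm_ring_1 poly^'n^'n"
proof -
  have "poly (of_int k :: 'f poly) z = of_int k" for k
    by (simp add: of_int_poly)
  then show ?thesis by (simp add: det_def poly_sum poly_prod)
qed

text \<open>
  The characteristic polynomial \<open>q(z) = det (z - A)\<close> is not constant. To see this without computing its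
  degree, compare it with \<open>p(w) = det (1 - w A) = w\<^sup>d q(1 / w)\<close>: a constant \<open>q\<close> would force
  \<open>p(w) \<rightarrow> 0\<close> as \<open>w \<rightarrow> 0\<close>, whereas \<open>p(0) = 1\<close>.
\<close>

lemma ex_complex_eigenvector:
  fixes A :: "complex^'n^'n"
  shows "\<exists>c v. v \<noteq> 0 \<and> A *v v = c *s v"
proof -
  let ?d = "CARD('n)"
  define q where "q = det (\<chi> i j. [:- A $ i $ j, if i = j then 1 else 0:])"
  define p where "p = det (\<chi> i j. [:if i = j then 1 else 0, - A $ i $ j:])"
  have q: "poly q z = det (\<chi> i j. (if i = j then z else 0) - A $ i $ j)" for z
    unfolding q_def poly_det by (intro arg_cong[where f = det]) (auto simp: vec_eq_iff)
  have p: "poly p w = det (\<chi> i j. (if i = j then 1 else 0) - w * A $ i $ j)" for w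
    unfolding p_def poly_det by (intro arg_cong[where f = det]) (auto simp: vec_eq_iff)
  have pq: "poly p w = w ^ ?d * poly q (1 / w)" if "w \<noteq> 0" for w
  proof -
    have "(\<chi> i j. (if i = j then 1 else 0) - w * A $ i $ j) =
        (\<chi> i. w *s (\<chi> j. (if i = j then 1 / w else 0) - A $ i $ j))"
      using that by (auto simp: vec_eq_iff right_diff_distrib)
    then show ?thesis
      unfolding p q by (simp add: det_rows_mul[of "\<lambda>i. w"])
  qed
  have p0: "poly p 0 = 1"
  proof -
    have "(\<chi> i j. (if i = j then 1 else 0) - 0 * A $ i $ j) = (mat 1 :: complex^'n^'n)"
      by (auto simp: vec_eq_iff mat_def)
    then show ?thesis unfolding p by simp
  qed
  have "\<not> constant (poly q)"
  proof
    assume "constant (poly q)"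
    then have c: "poly q z = poly q 0" for z by (auto simp: constant_def)
    have "((\<lambda>w. w ^ ?d * poly q 0) \<longlongrightarrow> 0 ^ ?d * poly q 0) (at 0)"
      by (intro tendsto_intros)
    moreover have "\<forall>\<^sub>F w in at 0. w ^ ?d * poly q 0 = poly p w"
      unfolding eventually_at_filter
    proof (intro always_eventually allI impI)
      fix w :: complex assume "w \<noteq> 0"
      then show "w ^ ?d * poly q 0 = poly p w" using pq[of w] c[of "1 / w"] by simp
    qed
    ultimately have "((\<lambda>w. poly p w) \<longlongrightarrow> 0 ^ ?d * poly q 0) (at 0)"
      by (rule Lim_transform_eventually)
    moreover have "((\<lambda>w. poly p w) \<longlongrightarrow> poly p 0) (at 0)"
      using isContD[OF poly_isCont] .
    ultimately have "poly p 0 = 0 ^ ?d * poly q 0" by (rule LIM_unique[rotated])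
    moreover have "(0::complex) ^ ?d = 0" by (simp only: power_0_left) simp
    ultimately show False by (simp add: p0)
  qed
  then obtain c where c: "poly q c = 0" using fundamental_theorem_of_algebra by blast
  let ?B = "(\<chi> i j. (if i = j then c else 0) - A $ i $ j) :: complex^'n^'n"
  have "\<not> invertible ?B" using c by (simp add: q invertible_det_nz)
  then have "\<not> (\<exists>B'. B' ** ?B = mat 1)"
    unfolding invertible_def using matrix_left_right_inverse by blast
  then obtain v where v: "v \<noteq> 0" "?B *v v = 0"
    unfolding matrix_left_invertible_ker by blast
  have "(?B *v v) $ i = (c *s v - A *v v) $ i" for i
  proof -
    have "(?B *v v) $ i = (\<Sum>j\<in>UNIV. (if i = j then c * v $ j else 0) - A $ i $ j * v $ j)"
      unfolding matrix_vector_mult_def by (simp, intro sum.cong) (auto simp: left_diff_distrib)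
    also have "\<dots> = (\<Sum>j\<in>UNIV. if i = j then c * v $ j else 0) - (A *v v) $ i"
      by (simp only: sum_subtractf) (simp add: matrix_vector_mult_def)
    finally show ?thesis by simp
  qed
  then have "?B *v v = c *s v - A *v v" unfolding vec_eq_iff by blast
  with v have "c *s v - A *v v = 0" by simp
  then have "A *v v = c *s v" by (simp only: right_minus_eq)
  with v(1) show ?thesis by blast
qed

text \<open>
  The rank-one matrix \<open>e\<^sub>i \<phi>\<close>, a projection onto the \<open>i\<close>-th coordinate axis along the kernel of \<open>\<phi>\<close> if
  \<open>\<phi>\<^sub>i = 1\<close>.
\<close>

definition row_projection :: "'n \<Rightarrow> 'f::real_normed_field^'n \<Rightarrow> 'f^'n^'n" where
  "row_projection i \<phi> = (\<chi> a. if a = i then \<phi> else 0)"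

lemma row_projection_mult_vec:
  "row_projection i \<phi> *v v = (\<Sum>j\<in>UNIV. \<phi> $ j * v $ j) *s axis i 1"
  by (auto simp: vec_eq_iff row_projection_def matrix_vector_mult_def axis_def)

lemma row_projection_idempotent:
  assumes "\<phi> $ i = 1"
  shows "row_projection i \<phi> ** row_projection i \<phi> = row_projection i \<phi>"
proof -
  have "(\<Sum>k\<in>UNIV. \<phi> $ k * (if k = i then \<phi> else 0) $ b) = \<phi> $ b" for b
  proof -
    have "(\<Sum>k\<in>UNIV. \<phi> $ k * (if k = i then \<phi> else 0) $ b) =
        (\<Sum>k\<in>UNIV. if k = i then \<phi> $ i * \<phi> $ b else 0)"
      by (intro sum.cong) auto
    then show ?thesis by (simp add: assms)
  qed
  then show ?thesis
    by (auto simp: vec_eq_iff row_projection_def matrix_matrix_mult_def)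
qed

lemma det_mat1_plus_row_projection:
  fixes \<phi> :: "'f::real_normed_field^'n"
  assumes "\<phi> $ i = 1"
  shows "det (mat 1 + \<delta> *\<^sub>R row_projection i \<phi>) = 1 + of_real \<delta>"
proof -
  define x where "x = axis i 1 + \<delta> *\<^sub>R \<phi>"
  have row: "row k (mat 1 :: 'f^'n^'n) = axis k 1" for k
    by (auto simp: vec_eq_iff row_def mat_def axis_def)
  have "sum (\<lambda>k. x $ k *s row k (mat 1 :: 'f^'n^'n)) UNIV = x"
    unfolding row by (auto simp: vec_eq_iff axis_def if_distrib cong: if_cong)
  then have eq: "mat 1 + \<delta> *\<^sub>R row_projection i \<phi> =
      (\<chi> a. if a = i then sum (\<lambda>k. x $ k *s row k (mat 1 :: 'f^'n^'n)) UNIV else row a (mat 1))"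
    by (auto simp: vec_eq_iff row_projection_def x_def row_def mat_def axis_def)
  have "det (mat 1 + \<delta> *\<^sub>R row_projection i \<phi>) = x $ i"
    unfolding eq cramer_lemma_transpose by simp
  also have "x $ i = 1 + \<delta> *\<^sub>R 1"
    by (simp only: x_def vector_add_component vector_scaleR_component axis_nth assms)
  finally show ?thesis by (simp only: of_real_def)
qed

text \<open>
  Idempotence of \<open>E\<close> is what makes the inverse of \<open>1 + \<delta>E\<close> explicit, and with it the
  distance of the perturbation measured also on inverses.
\<close>

definition destabilizable :: "'f::real_normed_field^'n^'n \<Rightarrow> bool" where
  "destabilizable A \<longleftrightarrow>
     (\<exists>E. E ** E = E \<and> (\<forall>\<delta>>0. unbounded_powers (A ** (mat 1 + \<delta> *\<^sub>R E))))"

lemma destabilizableI: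
  "E ** E = E \<Longrightarrow> (\<And>\<delta>. \<delta> > 0 \<Longrightarrow> unbounded_powers (A ** (mat 1 + \<delta> *\<^sub>R E))) \<Longrightarrow> destabilizable A"
  unfolding destabilizable_def by blast

lemma destabilizable_if_unbounded_powers:
  "unbounded_powers A \<Longrightarrow> destabilizable A"
  by (rule destabilizableI[of 0]) simp_all

text \<open>
  The factor \<open>1 + \<delta> e\<^sub>i \<phi>\<close> fixes \<open>v\<close> but has determinant \<open>1 + \<delta>\<close>. It therefore changes the determinant
  and not the eigenvalue, which breaks the equality necessary for bounded condition numbers.
\<close>

lemma unbounded_powers_row_perturbation:
  fixes A :: "complex^'n^'n"
  assumes A: "invertible A" and v: "v \<noteq> 0" "A *v v = c *s v"
    and eq: "norm c ^ CARD('n) = norm (det A)"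
    and \<phi>: "\<phi> $ i = 1" "(\<Sum>j\<in>UNIV. \<phi> $ j * v $ j) = 0" and \<delta>: "\<delta> > 0"
  shows "unbounded_powers (A ** (mat 1 + \<delta> *\<^sub>R row_projection i \<phi>))"
proof (rule unbounded_powers_eigenvector)
  let ?D = "mat 1 + \<delta> *\<^sub>R row_projection i \<phi>"
  have det: "det (A ** ?D) = det A * of_real (1 + \<delta>)"
    by (simp add: det_mul det_mat1_plus_row_projection \<phi>)
  have dA: "det A \<noteq> 0" using A by (simp add: invertible_det_nz)
  have "1 + complex_of_real \<delta> \<noteq> 0"
    using \<delta> by (auto simp: complex_eq_iff)
  then show "invertible (A ** ?D)" using dA by (simp add: invertible_det_nz det)
  have "(\<delta> *\<^sub>R row_projection i \<phi>) *v v = 0"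
    by (simp add: scaleR_mult_vec row_projection_mult_vec \<phi>)
  then have "?D *v v = v" by (simp add: matrix_vector_mult_add_rdistrib)
  then show "(A ** ?D) *v v = c *s v" by (simp add: matrix_vector_mul_assoc[symmetric] v)
  have "norm (det (A ** ?D)) = norm (det A) * (1 + \<delta>)"
    unfolding det norm_mult norm_of_real using \<delta> by simp
  moreover have "norm (det A) * 1 < norm (det A) * (1 + \<delta>)"
    by (rule mult_strict_left_mono) (use \<delta> dA in simp_all)
  ultimately show "norm c ^ CARD('n) \<noteq> norm (det (A ** ?D))" unfolding eq by linarith
qed (rule v)

lemma destabilizable_complex:
  fixes A :: "complex^'n^'n"
  assumes A: "invertible A" and d: "CARD('n) \<ge> 2"
  shows "destabilizable A"
proof -
  obtain c v where v: "v \<noteq> 0" "A *v v = c *s v" using ex_complex_eigenvector by blast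
  show ?thesis
  proof (cases "norm c ^ CARD('n) = norm (det A)")
    case False
    then show ?thesis
      by (intro destabilizable_if_unbounded_powers unbounded_powers_eigenvector[OF A v])
  next
    case True
    obtain i j :: 'n where ij: "i \<noteq> j"
      using d card_le_Suc0_iff_eq[of "UNIV :: 'n set"] by auto
    have "\<exists>k \<phi>. \<phi> $ k = 1 \<and> (\<Sum>j\<in>UNIV. \<phi> $ j * v $ j) = 0"
    proof (cases "v $ j = 0")
      case True
      have "(\<Sum>k\<in>UNIV. axis j 1 $ k * v $ k) = (\<Sum>k\<in>UNIV. if k = j then v $ j else 0)"
        by (intro sum.cong) (auto simp: axis_def)
      then show ?thesis using True by (intro exI[of _ j] exI[of _ "axis j 1"]) simp
    next
      case False
      \<comment> \<open>The row vector with entries \<open>1\<close> and \<open>- v\<^sub>i / v\<^sub>j\<close>, at the coordinates \<open>i\<close> and \<open>j\<close>.\<close>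
      let ?\<phi> = "axis i 1 + axis j (- v $ i / v $ j)"
      have "(\<Sum>k\<in>UNIV. ?\<phi> $ k * v $ k) =
          (\<Sum>k\<in>UNIV. (if k = i then v $ i else 0) + (if k = j then - v $ i else 0))"
        using False ij by (intro sum.cong) (auto simp: axis_def)
      then have "(\<Sum>k\<in>UNIV. ?\<phi> $ k * v $ k) = 0" by (simp add: sum.distrib)
      then show ?thesis using ij by (intro exI[of _ i] exI[of _ "?\<phi>"]) (simp add: axis_def)
    qed
    then obtain k \<phi> where \<phi>: "\<phi> $ k = 1" "(\<Sum>j\<in>UNIV. \<phi> $ j * v $ j) = 0" by blast
    show ?thesis
      by (rule destabilizableI[OF row_projection_idempotent[OF \<phi>(1)]
            unbounded_powers_row_perturbation[OF A v True \<phi>]])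
  qed
qed

definition complexify :: "real^'n^'n \<Rightarrow> complex^'n^'n" where
  "complexify A = (\<chi> i j. complex_of_real (A $ i $ j))"

lemma complexify_mult: "complexify (A ** B) = complexify A ** complexify B"
  by (simp add: complexify_def matrix_matrix_mult_def vec_eq_iff)

lemma complexify_mat1: "complexify (mat 1) = mat 1"
  by (simp add: complexify_def mat_def vec_eq_iff)

lemma complexify_mat1_plus_row_projection:
  "complexify (mat 1 + \<delta> *\<^sub>R row_projection i \<phi>) =
     mat 1 + \<delta> *\<^sub>R row_projection i (\<chi> j. complex_of_real (\<phi> $ j))"
  by (simp add: complexify_def mat_def row_projection_def vec_eq_iff scaleR_conv_of_real[where 'a = complex])

lemma det_complexify: "det (complexify A) = complex_of_real (det A)"
  by (simp add: det_def complexify_def)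

lemma invertible_complexify: "invertible (complexify A) \<longleftrightarrow> invertible A"
  by (simp add: invertible_det_nz det_complexify)

lemma complexify_matrix_inv:
  assumes "invertible A"
  shows "matrix_inv (complexify A) = complexify (matrix_inv A)"
  using assms
  by (intro matrix_inv_unique_right)
    (simp_all add: invertible_complexify complexify_mat1 matrix_inv_works flip: complexify_mult)

lemma complexify_matrix_power: "complexify (matrix_power A n) = matrix_power (complexify A) n"
  by (induction n) (simp_all add: complexify_mat1 complexify_mult)

lemma mnorm_complexify:
  fixes A :: "real^'n^'n"
  shows "mnorm (complexify A) \<le> (real CARD('n))\<^sup>2 * mnorm A"
proof -
  have "mnorm (complexify A) \<le> (\<Sum>i\<in>UNIV. \<Sum>j\<in>UNIV. norm (A $ i $ j))"
    using mnorm_le_entries[of "complexify A"] by (simp add: complexify_def)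
  also have "\<dots> \<le> (\<Sum>i\<in>(UNIV::'n set). \<Sum>j\<in>(UNIV::'n set). mnorm A)"
    by (intro sum_mono norm_entry_le_mnorm)
  finally show ?thesis by (simp add: power2_eq_square mult.assoc)
qed

lemma unbounded_powers_complexify:
  fixes A :: "real^'n^'n"
  assumes A: "invertible A" and unb: "unbounded_powers (complexify A)"
  shows "unbounded_powers A"
  unfolding unbounded_powers_def
proof
  fix C
  let ?k = "(real CARD('n))\<^sup>2"
  obtain n where n: "?k * ?k * C < cond_number (matrix_power (complexify A) n)"
    using unb unfolding unbounded_powers_def by blast
  let ?M = "matrix_power A n"
  have "cond_number (complexify ?M) \<le> (?k * mnorm ?M) * (?k * mnorm (matrix_inv ?M))"
    unfolding cond_number_def complexify_matrix_inv[OF invertible_matrix_power[OF A]]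
    by (intro mult_mono mnorm_complexify mult_nonneg_nonneg mnorm_nonneg) auto
  also have "\<dots> = ?k * ?k * cond_number ?M" by (simp add: cond_number_def)
  finally have "?k * ?k * C < ?k * ?k * cond_number ?M"
    using n unfolding complexify_matrix_power by linarith
  moreover have "0 < ?k * ?k" by simp
  ultimately have "C < cond_number ?M" by (simp only: mult_less_cancel_left_pos)
  then show "\<exists>n. C < cond_number (matrix_power A n)" by blast
qed

text \<open>
  The eigenvector may be non-real; a real row vector annihilates it exactly if it is orthogonal to
  its real and imaginary parts, and in dimension at least three there is a nonzero such vector.
\<close>

lemma destabilizable_real:
  fixes A :: "real^'n^'n"
  assumes A: "invertible A" and d: "CARD('n) \<ge> 3"
  shows "destabilizable A"
proof -
  obtain c v where v: "v \<noteq> 0" "complexify A *v v = c *s v" using ex_complex_eigenvector by blast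
  have cA: "invertible (complexify A)" by (simp add: invertible_complexify A)
  show ?thesis
  proof (cases "norm c ^ CARD('n) = norm (det (complexify A))")
    case False
    then show ?thesis
      by (intro destabilizable_if_unbounded_powers unbounded_powers_complexify[OF A]
          unbounded_powers_eigenvector[OF cA v])
  next
    case True
    define a b where "a = (\<chi> j. Re (v $ j))" and "b = (\<chi> j. Im (v $ j))"
    have "dim {a, b} \<le> card {a, b}" by (rule dim_le_card') simp
    also have "\<dots> \<le> 2" by (simp add: card_insert_if)
    also have "\<dots> < DIM(real^'n)" using d by simp
    finally obtain \<psi> where \<psi>: "\<psi> \<noteq> 0" and orth: "\<And>y. y \<in> span {a, b} \<Longrightarrow> orthogonal \<psi> y"
      by (rule orthogonal_to_subspace_exists) blast
    obtain k where k: "\<psi> $ k \<noteq> 0" using \<psi> by (auto simp: vec_eq_iff)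
    have "orthogonal \<psi> a" "orthogonal \<psi> b"
      by (auto intro!: orth span_base)
    then have ab: "(\<Sum>j\<in>UNIV. \<psi> $ j * Re (v $ j)) = 0" "(\<Sum>j\<in>UNIV. \<psi> $ j * Im (v $ j)) = 0"
      by (simp_all add: orthogonal_def inner_vec_def a_def b_def)
    define \<phi> where "\<phi> = (1 / \<psi> $ k) *\<^sub>R \<psi>"
    have \<phi>: "\<phi> $ k = 1" using k by (simp add: \<phi>_def)
    define \<phi>' where "\<phi>' = (\<chi> j. complex_of_real (\<phi> $ j))"
    have \<phi>': "\<phi>' $ k = 1" by (simp add: \<phi>'_def \<phi>)
    have "(\<Sum>j\<in>UNIV. \<phi> $ j * Re (v $ j)) = (\<Sum>j\<in>UNIV. \<psi> $ j * Re (v $ j)) / \<psi> $ k"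
      "(\<Sum>j\<in>UNIV. \<phi> $ j * Im (v $ j)) = (\<Sum>j\<in>UNIV. \<psi> $ j * Im (v $ j)) / \<psi> $ k"
      unfolding sum_divide_distrib by (simp_all add: \<phi>_def)
    then have "(\<Sum>j\<in>UNIV. \<phi>' $ j * v $ j) = 0"
      by (simp add: complex_eq_iff \<phi>'_def ab)
    note unb = unbounded_powers_row_perturbation[OF cA v True \<phi>' this]
    have "unbounded_powers (A ** (mat 1 + \<delta> *\<^sub>R row_projection k \<phi>))" if \<delta>: "\<delta> > 0" for \<delta>
    proof (rule unbounded_powers_complexify)
      have "1 + \<delta> \<noteq> 0" using \<delta> by simp
      then show "invertible (A ** (mat 1 + \<delta> *\<^sub>R row_projection k \<phi>))"
        using A det_mat1_plus_row_projection[where \<phi> = \<phi> and i = k and \<delta> = \<delta>, OF \<phi>]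
        by (simp add: invertible_det_nz det_mul)
      show "unbounded_powers (complexify (A ** (mat 1 + \<delta> *\<^sub>R row_projection k \<phi>)))"
        using unb[OF \<delta>]
        by (simp add: complexify_mult complexify_mat1_plus_row_projection \<phi>'_def)
    qed
    then show ?thesis by (rule destabilizableI[OF row_projection_idempotent[OF \<phi>]])
  qed
qed

section \<open>The space of continuous maps into the general linear group\<close>

lemma tendsto_mnorm:
  fixes f :: "'b \<Rightarrow> 'f::real_normed_field^'n^'n"
  assumes "(f \<longlongrightarrow> A) \<F>"
  shows "((\<lambda>x. mnorm (f x)) \<longlongrightarrow> mnorm A) \<F>"
proof -
  have "((\<lambda>x. \<Sum>i\<in>UNIV. \<Sum>j\<in>UNIV. norm ((f x - A) $ i $ j)) \<longlongrightarrow>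
      (\<Sum>i\<in>(UNIV::'n set). \<Sum>j\<in>(UNIV::'n set). norm ((A - A) $ i $ j))) \<F>"
    by (intro tendsto_intros assms)
  then have lim: "((\<lambda>x. \<Sum>i\<in>UNIV. \<Sum>j\<in>UNIV. norm ((f x - A) $ i $ j)) \<longlongrightarrow> 0) \<F>"
    by simp
  have "\<bar>mnorm (f x) - mnorm A\<bar> \<le> mnorm (f x - A)" for x
    using mnorm_triangle[of "f x - A" A] mnorm_triangle[of "A - f x" "f x"]
      mnorm_diff_commute[of A "f x"] by simp
  then have "norm (mnorm (f x) - mnorm A) \<le> (\<Sum>i\<in>UNIV. \<Sum>j\<in>UNIV. norm ((f x - A) $ i $ j))" for x
    unfolding real_norm_def by (rule order_trans[OF _ mnorm_le_entries])
  then have "((\<lambda>x. mnorm (f x) - mnorm A) \<longlongrightarrow> 0) \<F>"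
    by (intro Lim_null_comparison[OF always_eventually lim] allI)
  then show ?thesis by (simp add: LIM_zero_iff)
qed

lemma continuous_on_mnorm:
  "continuous_on S f \<Longrightarrow> continuous_on S (\<lambda>x. mnorm (f x :: 'f::real_normed_field^'n^'n))"
  unfolding continuous_on_def by (intro ballI tendsto_mnorm) simp

lemma continuous_on_cond_number:
  fixes f :: "'a::topological_space \<Rightarrow> 'f::real_normed_field^'n^'n"
  assumes "continuous_on S f" "\<And>x. x \<in> S \<Longrightarrow> invertible (f x)"
  shows "continuous_on S (\<lambda>x. cond_number (f x))"
  unfolding cond_number_def
  by (rule continuous_on_mult[OF continuous_on_mnorm[OF assms(1)]
        continuous_on_mnorm[OF continuous_on_matrix_inv[OF assms]]])

lemma tendsto_cond_number:
  fixes f :: "'b \<Rightarrow> 'f::real_normed_field^'n^'n"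
  assumes "(f \<longlongrightarrow> A) \<F>" "\<And>x. invertible (f x)" "invertible A"
  shows "((\<lambda>x. cond_number (f x)) \<longlongrightarrow> cond_number A) \<F>"
proof -
  have "continuous_on {A :: 'f^'n^'n. invertible A} cond_number"
    by (rule continuous_on_cond_number[OF continuous_on_id]) simp
  then show ?thesis
    by (rule continuous_on_tendsto_compose[OF _ assms(1)]) (use assms(2,3) in simp_all)
qed

lemma tendsto_matrix_mult:
  fixes f g :: "'b \<Rightarrow> 'f::real_normed_field^'n^'n"
  assumes "(f \<longlongrightarrow> A) \<F>" "(g \<longlongrightarrow> B) \<F>"
  shows "((\<lambda>x. f x ** g x) \<longlongrightarrow> A ** B) \<F>"
proof (intro vec_tendstoI)
  fix i j
  show "((\<lambda>x. (f x ** g x) $ i $ j) \<longlongrightarrow> (A ** B) $ i $ j) \<F>"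
    by (simp add: matrix_matrix_mult_def) (intro tendsto_sum tendsto_mult tendsto_vec_nth assms)
qed

lemma C0_GL_continuous: "F \<in> C0_GL \<Longrightarrow> continuous_on UNIV F"
  and C0_GL_invertible: "F \<in> C0_GL \<Longrightarrow> invertible (F x)"
  by (auto simp: C0_GL_def)

lemma C0_GL_bounded:
  fixes F :: "'a::topological_space \<Rightarrow> 'f::real_normed_field^'n^'n"
  assumes cpt: "compact (UNIV :: 'a set)" and F: "F \<in> C0_GL"
  obtains K where "K > 0" "\<And>x. mnorm (F x) \<le> K" "\<And>x. mnorm (matrix_inv (F x)) \<le> K"
proof -
  have "bdd_above (range (\<lambda>x. mnorm (F x - 0)))"
    by (intro bdd_above_mnorm_diff cpt C0_GL_continuous F continuous_on_const)
  moreover have "bdd_above (range (\<lambda>x. mnorm (matrix_inv (F x) - 0)))"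
    by (intro bdd_above_mnorm_diff cpt continuous_on_matrix_inv C0_GL_continuous C0_GL_invertible F
        continuous_on_const)
  ultimately obtain a b where ab: "\<And>x. mnorm (F x) \<le> a" "\<And>x. mnorm (matrix_inv (F x)) \<le> b"
    by (auto simp: bdd_above_def)
  show ?thesis
  proof (rule that[of "max 1 (max a b)"])
    show "mnorm (F x) \<le> max 1 (max a b)" for x using ab(1)[of x] by linarith
    show "mnorm (matrix_inv (F x)) \<le> max 1 (max a b)" for x using ab(2)[of x] by linarith
  qed simp
qed

lemma C0_dist_upper:
  fixes F G :: "'a::topological_space \<Rightarrow> 'f::real_normed_field^'n^'n"
  assumes cpt: "compact (UNIV :: 'a set)" and FG: "F \<in> C0_GL" "G \<in> C0_GL"
  shows "mnorm (F x - G x) + mnorm (matrix_inv (F x) - matrix_inv (G x)) \<le> C0_dist F G"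
proof -
  let ?e = "\<lambda>x. mnorm (F x - G x) + mnorm (matrix_inv (F x) - matrix_inv (G x))"
  have "continuous_on UNIV ?e"
    by (intro continuous_on_add continuous_on_mnorm continuous_on_diff continuous_on_matrix_inv
        C0_GL_continuous C0_GL_invertible FG)
  then have "bdd_above (range ?e)"
    by (intro bounded_imp_bdd_above compact_imp_bounded compact_continuous_image cpt)
  then show ?thesis
    using FG by (auto simp: C0_dist_def intro!: cSUP_upper2)
qed

lemma mnorm_diff_le_C0_dist:
  fixes F G :: "'a::topological_space \<Rightarrow> 'f::real_normed_field^'n^'n"
  assumes "compact (UNIV :: 'a set)" "F \<in> C0_GL" "G \<in> C0_GL"
  shows "mnorm (F x - G x) \<le> C0_dist F G"
    and "mnorm (matrix_inv (F x) - matrix_inv (G x)) \<le> C0_dist F G"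
  using C0_dist_upper[OF assms, of x] mnorm_nonneg[of "F x - G x"]
    mnorm_nonneg[of "matrix_inv (F x) - matrix_inv (G x)"] by linarith+

lemma C0_dist_le:
  fixes F G :: "'a::topological_space \<Rightarrow> 'f::real_normed_field^'n^'n"
  assumes "F \<in> C0_GL" "G \<in> C0_GL"
    and "\<And>x. mnorm (F x - G x) + mnorm (matrix_inv (F x) - matrix_inv (G x)) \<le> r"
  shows "C0_dist F G \<le> r"
  using assms by (auto simp: C0_dist_def intro!: cSUP_least)

lemma matrix_add_mult_right:
  fixes A B C :: "'f::real_normed_field^'n^'n"
  shows "(A + B) ** C = A ** C + B ** C"
  by (simp add: matrix_matrix_mult_def vec_eq_iff sum.distrib distrib_right)

lemma scaleR_matrix_mult:
  fixes A B :: "'f::real_normed_field^'n^'n"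
  shows "(r *\<^sub>R A) ** B = r *\<^sub>R (A ** B)" "A ** (r *\<^sub>R B) = r *\<^sub>R (A ** B)"
  by (simp_all add: matrix_matrix_mult_def vec_eq_iff scaleR_sum_right)

text \<open>
  For idempotent \<open>P\<close> the matrices \<open>1 + aP\<close> are closed under multiplication, with
  \<open>(1 + aP)(1 + bP) = 1 + (a + b + ab)P\<close>.
\<close>

lemma idempotent_perturbation_inverse:
  fixes P :: "'f::real_normed_field^'n^'n"
  assumes P: "P ** P = P" and \<delta>: "\<delta> > 0"
  shows "invertible (mat 1 + \<delta> *\<^sub>R P)"
    and "matrix_inv (mat 1 + \<delta> *\<^sub>R P) = mat 1 + (- (\<delta> / (1 + \<delta>))) *\<^sub>R P"
proof -
  have *: "(mat 1 + a *\<^sub>R P) ** (mat 1 + b *\<^sub>R P) = mat 1 + (a + b + a * b) *\<^sub>R P" for a b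
    by (simp only: matrix_add_ldistrib matrix_add_mult_right scaleR_matrix_mult P matrix_mul_lid
        matrix_mul_rid scaleR_add_left scaleR_add_right scaleR_scaleR add.assoc mult.commute[of b a])
  define c where "c = - (\<delta> / (1 + \<delta>))"
  have c: "\<delta> + c + \<delta> * c = 0" "c + \<delta> + c * \<delta> = 0"
    using \<delta> by (simp_all add: c_def field_simps)
  have inv: "(mat 1 + \<delta> *\<^sub>R P) ** (mat 1 + c *\<^sub>R P) = mat 1"
    "(mat 1 + c *\<^sub>R P) ** (mat 1 + \<delta> *\<^sub>R P) = mat 1"
    unfolding * c by simp_all
  show "invertible (mat 1 + \<delta> *\<^sub>R P)" unfolding invertible_def using inv by blast
  then show "matrix_inv (mat 1 + \<delta> *\<^sub>R P) = mat 1 + (- (\<delta> / (1 + \<delta>))) *\<^sub>R P"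
    using inv(1) unfolding c_def by (rule matrix_inv_unique_right)
qed

text \<open>
  Both perturbations of the cocycle, at a periodic orbit and along a tower, have this form; \<open>P\<close> is zero
  where nothing is changed.
\<close>

lemma C0_idempotent_perturbation:
  fixes F P :: "'a::topological_space \<Rightarrow> 'f::real_normed_field^'n^'n"
  assumes F: "F \<in> C0_GL"
    and K: "\<And>x. mnorm (F x) \<le> K" "\<And>x. mnorm (matrix_inv (F x)) \<le> K"
    and P: "continuous_on UNIV P" "\<And>x. P x ** P x = P x" "\<And>x. mnorm (P x) \<le> L"
    and \<delta>: "\<delta> > 0"
  defines "G \<equiv> \<lambda>x. F x ** (mat 1 + \<delta> *\<^sub>R P x)"
  shows "G \<in> C0_GL" "C0_dist F G \<le> 2 * K * L * \<delta>"
proof -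
  note inv = idempotent_perturbation_inverse[OF P(2) \<delta>]
  have "continuous_on UNIV G"
    unfolding G_def
    by (intro continuous_on_matrix_mult[OF C0_GL_continuous[OF F]] continuous_on_add
        continuous_on_const continuous_on_scaleR P(1))
  moreover have "invertible (G x)" for x
    unfolding G_def by (rule invertible_mult_field[OF C0_GL_invertible[OF F] inv(1)])
  ultimately show G: "G \<in> C0_GL" by (simp add: C0_GL_def)
  show "C0_dist F G \<le> 2 * K * L * \<delta>"
  proof (rule C0_dist_le[OF F G])
    fix x
    define c where "c = \<delta> / (1 + \<delta>)"
    have c: "0 \<le> c" "c \<le> \<delta>" using \<delta> by (simp_all add: c_def field_simps)
    have "F x - G x = (- \<delta>) *\<^sub>R (F x ** P x)"
      by (simp add: G_def matrix_add_ldistrib scaleR_matrix_mult)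
    then have "mnorm (F x - G x) = \<delta> * mnorm (F x ** P x)"
      using \<delta> by (simp only: mnorm_scaleR abs_minus_cancel abs_of_pos)
    also have "\<dots> \<le> \<delta> * (K * L)"
      using \<delta> by (intro mult_left_mono mnorm_mult_mono K P) auto
    finally have 1: "mnorm (F x - G x) \<le> K * L * \<delta>" by (simp add: mult_ac)
    have "matrix_inv (G x) = (mat 1 + (- c) *\<^sub>R P x) ** matrix_inv (F x)"
      unfolding G_def c_def by (simp only: matrix_inv_mult C0_GL_invertible[OF F] inv)
    also have "\<dots> = matrix_inv (F x) - c *\<^sub>R (P x ** matrix_inv (F x))"
      by (simp only: matrix_add_mult_right scaleR_matrix_mult matrix_mul_lid)
        (simp only: scaleR_minus_left add_uminus_conv_diff)
    finally have "matrix_inv (F x) - matrix_inv (G x) = c *\<^sub>R (P x ** matrix_inv (F x))"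
      by (simp only: diff_diff_eq2 add_diff_cancel_left')
    then have "mnorm (matrix_inv (F x) - matrix_inv (G x)) = c * mnorm (P x ** matrix_inv (F x))"
      using c by (simp only: mnorm_scaleR abs_of_nonneg)
    also have "\<dots> \<le> \<delta> * (L * K)"
      using \<delta> c by (intro mult_mono mnorm_mult_mono K P mnorm_nonneg) auto
    finally have "mnorm (matrix_inv (F x) - matrix_inv (G x)) \<le> K * L * \<delta>" by (simp add: mult_ac)
    with 1 show "mnorm (F x - G x) + mnorm (matrix_inv (F x) - matrix_inv (G x)) \<le> 2 * K * L * \<delta>"
      by simp
  qed
qed

section \<open>Cocycles over forward orbits\<close>

lemma cocycle_nat_cong:
  "(\<And>j. j < n \<Longrightarrow> F ((T ^^ j) x) = G ((T ^^ j) x)) \<Longrightarrow> cocycle_nat T F n x = cocycle_nat T G n x"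
  by (induction n) auto

lemma cocycle_nat_add:
  "cocycle_nat T F (m + n) x = cocycle_nat T F m ((T ^^ n) x) ** cocycle_nat T F n x"
  by (induction m) (simp_all add: matrix_mul_assoc funpow_add)

lemma cocycle_nat_mult_period:
  assumes "(T ^^ p) x = x"
  shows "cocycle_nat T F (k * p) x = matrix_power (cocycle_nat T F p x) k"
proof (induction k)
  case (Suc k)
  have "(T ^^ (k * p)) x = x"
  proof (induction k)
    case (Suc k)
    then show ?case by (simp add: funpow_add assms)
  qed simp
  then show ?case using Suc by (simp add: cocycle_nat_add)
qed simp

text \<open>
  By \<open>F\<^sup>(\<^sup>n\<^sup>)(T\<^sup>mx) = F\<^sup>(\<^sup>n\<^sup>+\<^sup>m\<^sup>)(x) F\<^sup>(\<^sup>m\<^sup>)(x)\<^sup>-\<^sup>1\<close>. A bound for the two-sided cocycle at one point thus gives its square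
  as a bound for the forward products starting anywhere on the orbit.
\<close>

lemma cond_number_cocycle_shift:
  assumes T: "bij T" and F: "\<And>x. invertible (F x)"
  shows "cond_number (cocycle_nat T F n (int_iter T m x)) \<le>
    cond_number (cocycle T F (int n + m) x) * cond_number (cocycle T F m x)"
proof -
  let ?A = "cocycle T F m x"
  have A: "invertible ?A" "invertible (cocycle T F (int n + m) x)"
    by (simp_all add: invertible_cocycle F)
  have "cocycle T F (int n + m) x = cocycle_nat T F n (int_iter T m x) ** ?A"
    by (simp add: cocycle_add[OF T F] cocycle_def[of T F "int n"])
  then have "cocycle T F (int n + m) x ** matrix_inv ?A =
      cocycle_nat T F n (int_iter T m x) ** (?A ** matrix_inv ?A)"
    by (simp only: matrix_mul_assoc)
  then have "cocycle_nat T F n (int_iter T m x) = cocycle T F (int n + m) x ** matrix_inv ?A"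
    by (simp add: matrix_inv_works A)
  then show ?thesis
    using cond_number_mult[OF A(2) invertible_matrix_inv[OF A(1)]]
    by (simp add: cond_number_matrix_inv A)
qed

section \<open>Clopen sets and towers\<close>

text \<open>
  Refine the cover \<open>{A, B}\<close> to an open partition and collect the pieces contained in \<open>A\<close>.
\<close>

lemma clopen_separation:
  fixes A B :: "'a::topological_space set"
  assumes zd: "zero_dimensional (euclidean :: 'a topology)"
    and "open A" "open B" "A \<union> B = UNIV"
  obtains V where "open V" "closed V" "- B \<subseteq> V" "V \<subseteq> A"
proof -
  have "(\<forall>U\<in>{A, B}. openin euclidean U) \<and> \<Union>{A, B} = topspace euclidean"
    using assms by auto
  from zd[unfolded zero_dimensional_def, THEN spec, THEN mp, OF this]
  obtain P where P: "partition_on (UNIV :: 'a set) P" "\<And>p. p \<in> P \<Longrightarrow> open p"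
    "\<And>p. p \<in> P \<Longrightarrow> p \<subseteq> A \<or> p \<subseteq> B"
    by auto
  have un: "\<exists>p\<in>P. x \<in> p" for x
    using P(1) by (metis UNIV_I UnionE partition_onD1)
  have disj: "\<And>p q. p \<in> P \<Longrightarrow> q \<in> P \<Longrightarrow> p \<noteq> q \<Longrightarrow> p \<inter> q = {}"
    using P(1) by (auto simp: partition_on_def disjoint_def)
  let ?V = "\<Union>{p \<in> P. p \<subseteq> A}"
  have "- ?V = \<Union>{p \<in> P. \<not> p \<subseteq> A}"
  proof (intro equalityI subsetI)
    fix x assume "x \<in> - ?V"
    moreover obtain p where "p \<in> P" "x \<in> p" using un by blast
    ultimately show "x \<in> \<Union>{p \<in> P. \<not> p \<subseteq> A}" by auto
  next
    fix x assume "x \<in> \<Union>{p \<in> P. \<not> p \<subseteq> A}"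
    then obtain p where p: "p \<in> P" "\<not> p \<subseteq> A" "x \<in> p" by auto
    show "x \<in> - ?V"
    proof
      assume "x \<in> ?V"
      then obtain q where "q \<in> P" "q \<subseteq> A" "x \<in> q" by auto
      then show False using p disj[of p q] by auto
    qed
  qed
  moreover have "open (\<Union>{p \<in> P. \<not> p \<subseteq> A})" using P(2) by (intro open_Union) simp
  ultimately have "closed ?V" by (simp add: closed_open)
  moreover have "open ?V" using P(2) by (intro open_Union) simp
  moreover have "- B \<subseteq> ?V"
  proof
    fix x assume "x \<in> - B"
    moreover obtain p where "p \<in> P" "x \<in> p" using un by blast
    ultimately show "x \<in> ?V" using P(3)[of p] by auto
  qed
  moreover have "?V \<subseteq> A" by auto
  ultimately show ?thesis by (intro that)
qed

lemma continuous_on_if_clopen: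
  fixes f :: "'a::topological_space \<Rightarrow> 'b::{topological_space, zero}"
  assumes U: "open U" "closed U" and f: "continuous_on UNIV f"
  shows "continuous_on UNIV (\<lambda>x. if x \<in> U then f x else 0)"
proof -
  have "continuous_on (U \<union> - U) (\<lambda>x. if x \<in> U then f x else 0)"
  proof (rule continuous_on_cases)
    show "closed U" "closed (- U)" using U by (simp_all add: closed_Compl)
    show "continuous_on U f" by (rule continuous_on_subset[OF f]) simp
  qed auto
  then show ?thesis by simp
qed

locale compact_homeomorphism =
  fixes T :: "'a::metric_space \<Rightarrow> 'a"
  assumes compact_space: "compact (UNIV :: 'a set)"
    and homeo: "homeomorphism UNIV UNIV T (inv T)"
begin

lemma bij_T: "bij T"
  using homeo by (metis UNIV_I homeomorphism_def bijI')

lemma continuous_int_iter: "continuous_on UNIV (int_iter T n)"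
proof -
  have "continuous_on UNIV T" "continuous_on UNIV (inv T)"
    using homeo by (simp_all add: homeomorphism_def)
  then have "continuous_on UNIV (T ^^ k)" "continuous_on UNIV (inv T ^^ k)" for k
    by (auto intro: continuous_on_funpow)
  moreover have "int_iter T n = (if 0 \<le> n then T ^^ nat n else inv T ^^ nat (- n))"
    by (rule ext) (simp add: int_iter_def)
  ultimately show ?thesis by simp
qed

lemma continuous_T: "continuous_on UNIV T"
  using homeo by (simp add: homeomorphism_def)

lemma int_iter_of_nat: "int_iter T (int n) x = (T ^^ n) x"
  by (simp add: int_iter_def)

lemma int_iter_int_iter: "int_iter T m (int_iter T n x) = int_iter T (m + n) x"
  by (simp add: int_iter_add[OF bij_T])

lemma int_iter_cancel: "int_iter T (- n) (int_iter T n x) = x"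
  by (simp add: int_iter_int_iter int_iter_0)

lemma open_closed_preimage_int_iter:
  "open U \<Longrightarrow> open {x. int_iter T n x \<in> U}" "closed U \<Longrightarrow> closed {x. int_iter T n x \<in> U}"
  using open_vimage[OF _ continuous_int_iter, of U n] closed_vimage[OF _ continuous_int_iter, of U n]
  by (simp_all add: vimage_def)

definition tower_base :: "nat \<Rightarrow> 'a set \<Rightarrow> bool" where
  "tower_base N U \<longleftrightarrow> open U \<and> closed U \<and> (\<forall>x\<in>U. \<forall>j. 0 < j \<and> j < N \<longrightarrow> (T ^^ j) x \<notin> U)"

lemma tower_baseD:
  "tower_base N U \<Longrightarrow> x \<in> U \<Longrightarrow> 0 < j \<Longrightarrow> j < N \<Longrightarrow> (T ^^ j) x \<notin> U"
  by (simp add: tower_base_def)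

text \<open>
  Return times within the base being at least \<open>N\<close>, a point lies on at most one of the levels
  \<open>U, TU, \<dots>, T\<^sup>N\<^sup>-\<^sup>1U\<close>.
\<close>

lemma tower_base_levels_disjoint:
  assumes U: "tower_base N U" and x: "x \<in> U" and ij: "i < N" "j < N"
    and i: "int_iter T (- int i) ((T ^^ j) x) \<in> U"
  shows "i = j"
proof (rule ccontr)
  assume "i \<noteq> j"
  let ?y = "int_iter T (- int i) ((T ^^ j) x)"
  have y: "?y = int_iter T (int j - int i) x"
    unfolding int_iter_of_nat[symmetric] int_iter_int_iter by simp
  show False
  proof (cases "i < j")
    case True
    then have "?y = (T ^^ (j - i)) x"
      unfolding int_iter_of_nat[symmetric] int_iter_int_iter by (simp add: of_nat_diff)
    moreover have "0 < j - i" "j - i < N" using ij True by auto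
    ultimately show False using tower_baseD[OF U x, of "j - i"] i by simp
  next
    case False
    then have "j < i" using \<open>i \<noteq> j\<close> by simp
    then have "(T ^^ (i - j)) ?y = x"
      unfolding y int_iter_of_nat[symmetric] int_iter_int_iter by (simp add: of_nat_diff int_iter_0)
    moreover have "0 < i - j" "i - j < N" using ij \<open>j < i\<close> by auto
    ultimately show False using tower_baseD[OF U i, of "i - j"] x by simp
  qed
qed

lemma ex_tower_base_at:
  assumes zd: "zero_dimensional (euclidean :: 'a topology)"
    and x: "\<And>j. 0 < j \<Longrightarrow> j < N \<Longrightarrow> (T ^^ j) x \<noteq> x"
  shows "\<exists>B. tower_base N B \<and> x \<in> B"
proof -
  have "\<exists>W. open W \<and> x \<in> W \<and> (\<forall>y\<in>W. (T ^^ j) y \<notin> W)" if j: "0 < j" "j < N" for j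
  proof -
    obtain W1 W2 where W: "open W1" "open W2" "x \<in> W1" "(T ^^ j) x \<in> W2" "W1 \<inter> W2 = {}"
      using hausdorff[OF x[OF j]] by blast
    have "open (W1 \<inter> {y. int_iter T (int j) y \<in> W2})"
      by (intro open_Int W open_closed_preimage_int_iter)
    then show ?thesis
      using W by (intro exI[of _ "W1 \<inter> {y. int_iter T (int j) y \<in> W2}"])
        (auto simp: int_iter_of_nat)
  qed
  then have "\<forall>j\<in>{0<..<N}. \<exists>W. open W \<and> x \<in> W \<and> (\<forall>y\<in>W. (T ^^ j) y \<notin> W)"
    by simp
  from bchoice[OF this]
  obtain W where "\<forall>j\<in>{0<..<N}. open (W j) \<and> x \<in> W j \<and> (\<forall>y\<in>W j. (T ^^ j) y \<notin> W j)" ..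
  then have W: "\<And>j. 0 < j \<Longrightarrow> j < N \<Longrightarrow> open (W j)" "\<And>j. 0 < j \<Longrightarrow> j < N \<Longrightarrow> x \<in> W j"
    "\<And>j y. 0 < j \<Longrightarrow> j < N \<Longrightarrow> y \<in> W j \<Longrightarrow> (T ^^ j) y \<notin> W j"
    by simp_all
  let ?O = "\<Inter>j\<in>{0<..<N}. W j"
  have "open ?O" using W(1) by (intro open_INT) auto
  moreover have "open (UNIV - {x})" by (intro open_Diff) auto
  moreover have "?O \<union> (UNIV - {x}) = UNIV" using W(2) by auto
  ultimately obtain B where B: "open B" "closed B" "- (UNIV - {x}) \<subseteq> B" "B \<subseteq> ?O"
    by (rule clopen_separation[OF zd])
  have "(T ^^ j) y \<notin> B" if "y \<in> B" "0 < j" "j < N" for y j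
  proof -
    have "y \<in> W j" using that B(4) by auto
    then have "(T ^^ j) y \<notin> W j" using W(3) that by blast
    then show ?thesis using that B(4) by auto
  qed
  then show ?thesis using B unfolding tower_base_def by blast
qed

text \<open>
  Greedy construction: from the next base \<open>B\<close> remove the points whose orbit passes through \<open>U\<close> within \<open>N\<close>
  steps in either time direction, and add the rest to \<open>U\<close>. The removed points already visit \<open>U\<close>, and what is
  left cannot interfere with its tower.
\<close>

lemma merge_tower_bases:
  assumes "finite \<B>" "\<And>B. B \<in> \<B> \<Longrightarrow> tower_base N B"
  shows "\<exists>U \<subseteq> \<Union>\<B>. tower_base N U \<and> (\<forall>x\<in>\<Union>\<B>. \<exists>m. int_iter T m x \<in> U)"
  using assms
proof (induction \<B> rule: finite_induct)
  case empty
  then show ?case by (intro exI[of _ "{}"]) (simp add: tower_base_def)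
next
  case (insert B \<B>)
  then obtain U where U: "U \<subseteq> \<Union>\<B>" "tower_base N U" "\<And>x. x \<in> \<Union>\<B> \<Longrightarrow> \<exists>m. int_iter T m x \<in> U"
    by blast
  have B: "tower_base N B" using insert.prems by blast
  define J where "J = {- int N..int N}"
  define S where "S = (\<Union>k\<in>J. {x. int_iter T k x \<in> U})"
  have S: "x \<in> S \<longleftrightarrow> (\<exists>k\<in>J. int_iter T k x \<in> U)" for x by (auto simp: S_def)
  let ?U = "U \<union> (B - S)"
  have clopU: "open U" "closed U" and clopB: "open B" "closed B"
    using U(2) B by (auto simp: tower_base_def)
  have "open S" unfolding S_def using clopU by (intro open_UN ballI open_closed_preimage_int_iter)
  moreover have "closed S" unfolding S_def J_def
    using clopU by (intro closed_UN ballI open_closed_preimage_int_iter) auto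
  ultimately have clop: "open ?U" "closed ?U"
    using clopU clopB by (auto intro!: open_Un closed_Un open_Diff closed_Diff)
  have "(T ^^ j) x \<notin> ?U" if x: "x \<in> ?U" and j: "0 < j" "j < N" for x j
  proof
    assume Tx: "(T ^^ j) x \<in> ?U"
    have kJ: "int j \<in> J" "- int j \<in> J" using j by (auto simp: J_def)
    consider "x \<in> U" "(T ^^ j) x \<in> U" | "x \<in> U" "(T ^^ j) x \<in> B - S"
      | "x \<in> B - S" "(T ^^ j) x \<in> U" | "x \<in> B - S" "(T ^^ j) x \<in> B - S"
      using x Tx by blast
    then show False
    proof cases
      case 1
      then show False using U(2) j by (auto simp: tower_base_def)
    next
      case 2
      have "int_iter T (- int j) ((T ^^ j) x) \<in> U"
        using 2(1) int_iter_cancel[of "int j" x] by (simp add: int_iter_of_nat)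
      then show False using 2(2) kJ(2) S by blast
    next
      case 3
      then have "int_iter T (int j) x \<in> U" by (simp add: int_iter_of_nat)
      then show False using 3(1) kJ(1) S by blast
    next
      case 4
      then show False using B j by (auto simp: tower_base_def)
    qed
  qed
  then have tb: "tower_base N ?U" using clop unfolding tower_base_def by blast
  have orb: "\<exists>m. int_iter T m x \<in> ?U" if "x \<in> \<Union>(insert B \<B>)" for x
  proof (cases "x \<in> \<Union>\<B>")
    case True
    then show ?thesis using U(3) by blast
  next
    case False
    then have xB: "x \<in> B" using that by blast
    show ?thesis
    proof (cases "x \<in> S")
      case True
      then show ?thesis using S by blast
    next
      case False
      then have "int_iter T 0 x \<in> ?U" using xB by (simp add: int_iter_0)
      then show ?thesis by blast
    qed
  qed
  have "?U \<subseteq> \<Union>(insert B \<B>)" using U(1) by blast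
  then show ?case using tb orb by blast
qed

lemma ex_tower_base:
  assumes zd: "zero_dimensional (euclidean :: 'a topology)"
    and Y: "open Y" "closed Y"
    and aper: "\<And>x j. x \<in> Y \<Longrightarrow> 0 < j \<Longrightarrow> j < N \<Longrightarrow> (T ^^ j) x \<noteq> x"
  obtains U where "U \<subseteq> Y" "tower_base N U" "\<And>x. x \<in> Y \<Longrightarrow> \<exists>m. int_iter T m x \<in> U"
proof -
  have "\<exists>B. tower_base N B \<and> x \<in> B \<and> B \<subseteq> Y" if x: "x \<in> Y" for x
  proof -
    obtain B where B: "tower_base N B" "x \<in> B"
      using ex_tower_base_at[OF zd aper[OF x]] by blast
    then have "tower_base N (B \<inter> Y)" using Y by (auto simp: tower_base_def)
    then show ?thesis using B(2) x by blast
  qed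
  then have "\<forall>x\<in>Y. \<exists>B. tower_base N B \<and> x \<in> B \<and> B \<subseteq> Y" by blast
  from bchoice[OF this] obtain B where "\<forall>x\<in>Y. tower_base N (B x) \<and> x \<in> B x \<and> B x \<subseteq> Y" ..
  then have B: "\<And>x. x \<in> Y \<Longrightarrow> tower_base N (B x) \<and> x \<in> B x \<and> B x \<subseteq> Y" by blast
  have "compact Y" using compact_Int_closed[OF compact_space Y(2)] by simp
  then obtain D where D: "D \<subseteq> Y" "finite D" "Y \<subseteq> (\<Union>x\<in>D. B x)"
    by (rule compactE_image[of Y Y B]) (use B in \<open>auto simp: tower_base_def\<close>)
  have "\<exists>U \<subseteq> \<Union>(B ` D). tower_base N U \<and> (\<forall>x\<in>\<Union>(B ` D). \<exists>m. int_iter T m x \<in> U)"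
  proof (rule merge_tower_bases)
    show "finite (B ` D)" using D(2) by (rule finite_imageI)
    show "tower_base N b" if "b \<in> B ` D" for b using that B D(1) by blast
  qed
  then obtain U where U: "U \<subseteq> \<Union>(B ` D)" "tower_base N U"
    "\<And>x. x \<in> \<Union>(B ` D) \<Longrightarrow> \<exists>m. int_iter T m x \<in> U"
    by blast
  show ?thesis
  proof (rule that[of U])
    show "U \<subseteq> Y" using U(1) B D(1) by blast
    show "\<exists>m. int_iter T m x \<in> U" if "x \<in> Y" for x using U(3) D(3) that by blast
  qed (rule U(2))
qed

section \<open>Stability under perturbation of the cocycle\<close>

lemma continuous_cond_number_cocycle_nat:
  fixes F :: "'a \<Rightarrow> 'f::real_normed_field^'n^'n"
  assumes F: "F \<in> C0_GL"
  shows "continuous_on UNIV (\<lambda>x. cond_number (cocycle_nat T F n x))"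
proof (rule continuous_on_cond_number)
  show "continuous_on UNIV (\<lambda>x. cocycle_nat T F n x)"
    by (rule continuous_on_cocycle_nat[OF continuous_T C0_GL_continuous[OF F]])
  show "invertible (cocycle_nat T F n x)" for x
    by (rule invertible_cocycle_nat) (rule C0_GL_invertible[OF F])
qed

text \<open>
  Uniform convergence allows the evaluation points to move.
\<close>

lemma tendsto_C0_eval:
  fixes G :: "'a \<Rightarrow> 'f::real_normed_field^'n^'n"
  assumes G: "G \<in> C0_GL" and H: "\<And>k. H k \<in> C0_GL" and lim: "(\<lambda>k. C0_dist (H k) G) \<longlonglongrightarrow> 0"
    and y: "y \<longlonglongrightarrow> z"
  shows "(\<lambda>k. H k (y k)) \<longlonglongrightarrow> G z"
proof -
  have "(\<lambda>k. H k (y k) - G (y k)) \<longlonglongrightarrow> 0"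
  proof (intro vec_tendstoI)
    fix i j
    have "norm ((H k (y k) - G (y k)) $ i $ j) \<le> C0_dist (H k) G" for k
      using norm_entry_le_mnorm mnorm_diff_le_C0_dist(1)[OF compact_space H G] by (rule order_trans)
    then have "(\<lambda>k. (H k (y k) - G (y k)) $ i $ j) \<longlonglongrightarrow> 0"
      by (intro Lim_null_comparison[OF always_eventually lim] allI)
    then show "(\<lambda>k. (H k (y k) - G (y k)) $ i $ j) \<longlonglongrightarrow> 0 $ i $ j" by simp
  qed
  moreover have "(\<lambda>k. G (y k)) \<longlonglongrightarrow> G z"
    by (rule continuous_on_tendsto_compose[OF C0_GL_continuous[OF G] y]) simp_all
  ultimately have "(\<lambda>k. (H k (y k) - G (y k)) + G (y k)) \<longlonglongrightarrow> 0 + G z"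
    by (rule tendsto_add)
  then show ?thesis by simp
qed

lemma tendsto_cocycle_nat:
  fixes G :: "'a \<Rightarrow> 'f::real_normed_field^'n^'n"
  assumes G: "G \<in> C0_GL" and H: "\<And>k. H k \<in> C0_GL" and lim: "(\<lambda>k. C0_dist (H k) G) \<longlonglongrightarrow> 0"
    and y: "y \<longlonglongrightarrow> z"
  shows "(\<lambda>k. cocycle_nat T (H k) n (y k)) \<longlonglongrightarrow> cocycle_nat T G n z"
proof (induction n)
  case (Suc n)
  have "(\<lambda>k. (T ^^ n) (y k)) \<longlonglongrightarrow> (T ^^ n) z"
    by (rule continuous_on_tendsto_compose[OF continuous_on_funpow[OF continuous_T] y]) simp_all
  then have "(\<lambda>k. H k ((T ^^ n) (y k))) \<longlonglongrightarrow> G ((T ^^ n) z)"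
    by (rule tendsto_C0_eval[OF G H lim])
  from tendsto_matrix_mult[OF this Suc] show ?case by simp
qed simp

lemma tendsto_cond_number_cocycle_nat:
  fixes G :: "'a \<Rightarrow> 'f::real_normed_field^'n^'n"
  assumes G: "G \<in> C0_GL" and H: "\<And>k. H k \<in> C0_GL" and lim: "(\<lambda>k. C0_dist (H k) G) \<longlonglongrightarrow> 0"
    and y: "y \<longlonglongrightarrow> z"
  shows "(\<lambda>k. cond_number (cocycle_nat T (H k) n (y k))) \<longlonglongrightarrow> cond_number (cocycle_nat T G n z)"
proof (rule tendsto_cond_number[OF tendsto_cocycle_nat[OF G H lim y]])
  show "invertible (cocycle_nat T (H k) n (y k))" for k
    by (rule invertible_cocycle_nat) (rule C0_GL_invertible[OF H])
  show "invertible (cocycle_nat T G n z)"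
    by (rule invertible_cocycle_nat) (rule C0_GL_invertible[OF G])
qed

text \<open>
  Reduces openness statements to limits of sequences, which combine with the sequential compactness
  of the space.
\<close>

lemma C0_sequence_if_no_stability:
  fixes G :: "'a \<Rightarrow> 'f::real_normed_field^'n^'n"
  assumes G: "G \<in> C0_GL" and no: "\<not> (\<exists>\<rho>>0. \<forall>H\<in>C0_GL. C0_dist H G < \<rho> \<longrightarrow> Q H)"
  shows "\<exists>H. (\<forall>k::nat. H k \<in> C0_GL) \<and> (\<lambda>k. C0_dist (H k) G) \<longlonglongrightarrow> 0 \<and> (\<forall>k. \<not> Q (H k))"
proof -
  have "\<forall>k::nat. \<exists>H. H \<in> C0_GL \<and> C0_dist H G < 1 / real (Suc k) \<and> \<not> Q H"
  proof
    fix k :: nat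
    have "0 < 1 / real (Suc k)" by simp
    then show "\<exists>H. H \<in> C0_GL \<and> C0_dist H G < 1 / real (Suc k) \<and> \<not> Q H" using no by blast
  qed
  from choice[OF this] obtain H
    where H: "\<forall>k. H k \<in> C0_GL \<and> C0_dist (H k) G < 1 / real (Suc k) \<and> \<not> Q (H k)" ..
  have "0 \<le> C0_dist (H k) G" for k
    by (rule Metric_space.nonneg[OF Metric_space_C0[OF compact_space]])
  then have "norm (C0_dist (H k) G) \<le> 1 / real (Suc k)" for k
    using H by (simp add: less_imp_le)
  then have "\<forall>\<^sub>F k in sequentially. norm (C0_dist (H k) G) \<le> 1 / real (Suc k)"
    by (intro always_eventually allI)
  then have "(\<lambda>k. C0_dist (H k) G) \<longlonglongrightarrow> 0"
    by (rule Lim_null_comparison) (rule LIMSEQ_Suc[OF lim_1_over_n])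
  then show ?thesis using H by (intro exI[of _ H]) simp
qed

lemma stable_cond_number_at_point:
  fixes G :: "'a \<Rightarrow> 'f::real_normed_field^'n^'n"
  assumes G: "G \<in> C0_GL" and C: "C < cond_number (cocycle_nat T G n x)"
  shows "\<exists>\<rho>>0. \<forall>H\<in>C0_GL. C0_dist H G < \<rho> \<longrightarrow> C < cond_number (cocycle_nat T H n x)"
proof (rule ccontr)
  assume "\<not> ?thesis"
  from C0_sequence_if_no_stability[OF G this]
  obtain H where H: "\<And>k::nat. H k \<in> C0_GL" "(\<lambda>k. C0_dist (H k) G) \<longlonglongrightarrow> 0"
    "\<And>k. \<not> C < cond_number (cocycle_nat T (H k) n x)"
    by blast
  have "(\<lambda>k. cond_number (cocycle_nat T (H k) n x)) \<longlonglongrightarrow> cond_number (cocycle_nat T G n x)"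
    by (rule tendsto_cond_number_cocycle_nat[OF G H(1,2) tendsto_const])
  then have "cond_number (cocycle_nat T G n x) \<le> C"
    by (rule LIMSEQ_le_const2) (use H(3) in \<open>auto simp: not_less\<close>)
  then show False using C by simp
qed

text \<open>
  The starting point of the product may be anywhere on the orbit, so \<open>m\<close> ranges over all integers,
  while the number of steps is a natural number.
\<close>

definition all_orbits_exceed :: "real \<Rightarrow> ('a \<Rightarrow> 'f::real_normed_field^'n^'n) \<Rightarrow> bool" where
  "all_orbits_exceed C F \<longleftrightarrow> (\<forall>x. \<exists>m n. C < cond_number (cocycle_nat T F n (int_iter T m x)))"

text \<open>
  A failure of stability gives cocycles \<open>H\<^sub>k \<rightarrow> G\<close> and points \<open>x\<^sub>k\<close> with orbits bounded by \<open>C\<close>; the orbit of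
  any accumulation point of \<open>x\<^sub>k\<close> is then bounded by \<open>C\<close> for \<open>G\<close>.
\<close>

lemma stable_all_orbits_exceed:
  fixes G :: "'a \<Rightarrow> 'f::real_normed_field^'n^'n"
  assumes G: "G \<in> C0_GL" and C: "all_orbits_exceed C G"
  shows "\<exists>\<rho>>0. \<forall>H\<in>C0_GL. C0_dist H G < \<rho> \<longrightarrow> all_orbits_exceed C H"
proof (rule ccontr)
  assume "\<not> ?thesis"
  from C0_sequence_if_no_stability[OF G this]
  obtain H where H: "\<And>k::nat. H k \<in> C0_GL" "(\<lambda>k. C0_dist (H k) G) \<longlonglongrightarrow> 0"
    "\<And>k. \<not> all_orbits_exceed C (H k)"
    by blast
  have "\<forall>k. \<exists>x. \<forall>m n. cond_number (cocycle_nat T (H k) n (int_iter T m x)) \<le> C"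
    using H(3) by (simp add: all_orbits_exceed_def not_less)
  from choice[OF this] obtain x
    where x: "\<forall>k m n. cond_number (cocycle_nat T (H k) n (int_iter T m (x k))) \<le> C" ..
  have "seq_compact (UNIV :: 'a set)" using compact_space by (simp add: compact_eq_seq_compact_metric)
  then obtain z r where r: "strict_mono (r :: nat \<Rightarrow> nat)" "(x \<circ> r) \<longlonglongrightarrow> z"
    unfolding seq_compact_def by (metis UNIV_I)
  obtain m n where mn: "C < cond_number (cocycle_nat T G n (int_iter T m z))"
    using C unfolding all_orbits_exceed_def by blast
  have "(\<lambda>k. int_iter T m ((x \<circ> r) k)) \<longlonglongrightarrow> int_iter T m z"
    by (rule continuous_on_tendsto_compose[OF continuous_int_iter r(2)]) simp_all
  moreover have "(\<lambda>k. C0_dist (H (r k)) G) \<longlonglongrightarrow> 0"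
    using LIMSEQ_subseq_LIMSEQ[OF H(2) r(1)] by (simp add: o_def)
  ultimately have "(\<lambda>k. cond_number (cocycle_nat T (H (r k)) n (int_iter T m ((x \<circ> r) k))))
      \<longlonglongrightarrow> cond_number (cocycle_nat T G n (int_iter T m z))"
    by (intro tendsto_cond_number_cocycle_nat[OF G]) (rule H(1))
  then have "cond_number (cocycle_nat T G n (int_iter T m z)) \<le> C"
    by (rule LIMSEQ_le_const2) (use x in auto)
  then show False using mn by simp
qed

section \<open>Periodic points\<close>

text \<open>
  Let \<open>p\<close> be the least period. Changing \<open>F\<close> only on a clopen neighbourhood of \<open>x\<close> which the orbit visits once
  per period multiplies the return matrix \<open>F\<^sup>(\<^sup>p\<^sup>)(x)\<close> by the chosen factor.
\<close>

lemma exceed_at_periodic_point: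
  fixes F :: "'a \<Rightarrow> 'f::real_normed_field^'n^'n"
  assumes zd: "zero_dimensional (euclidean :: 'a topology)"
    and destab: "\<And>A :: 'f^'n^'n. invertible A \<Longrightarrow> destabilizable A"
    and F: "F \<in> C0_GL" and \<epsilon>: "\<epsilon> > 0" and x: "\<exists>p\<ge>1. (T ^^ p) x = x"
  shows "\<exists>G\<in>C0_GL. C0_dist F G < \<epsilon> \<and> (\<exists>n. C < cond_number (cocycle_nat T G n x))"
proof -
  define p where "p = (LEAST p. p \<ge> 1 \<and> (T ^^ p) x = x)"
  have p: "p \<ge> 1" "(T ^^ p) x = x"
    using LeastI_ex[of "\<lambda>p. p \<ge> 1 \<and> (T ^^ p) x = x"] x unfolding p_def by auto
  have aper: "(T ^^ j) x \<noteq> x" if "0 < j" "j < p" for j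
    using not_less_Least[of j "\<lambda>p. p \<ge> 1 \<and> (T ^^ p) x = x"] that unfolding p_def by auto
  obtain B where B: "tower_base p B" "x \<in> B"
    using ex_tower_base_at[OF zd aper] by blast
  have clop: "open B" "closed B" using B(1) by (simp_all add: tower_base_def)
  let ?A = "cocycle_nat T F p x"
  have "invertible ?A" by (rule invertible_cocycle_nat) (rule C0_GL_invertible[OF F])
  then obtain E where E: "E ** E = E" "\<And>\<delta>. \<delta> > 0 \<Longrightarrow> unbounded_powers (?A ** (mat 1 + \<delta> *\<^sub>R E))"
    using destab unfolding destabilizable_def by blast
  obtain K where K: "K > 0" "\<And>x. mnorm (F x) \<le> K" "\<And>x. mnorm (matrix_inv (F x)) \<le> K"
    using C0_GL_bounded[OF compact_space F] by blast
  define L where "L = mnorm E + 1"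
  have L: "L > 0" "mnorm E \<le> L" using mnorm_nonneg[of E] by (simp_all add: L_def)
  define \<delta> where "\<delta> = \<epsilon> / (4 * K * L)"
  have \<delta>: "\<delta> > 0" using \<epsilon> K L by (simp add: \<delta>_def)
  define P where "P = (\<lambda>y. if y \<in> B then E else 0)"
  define G where "G = (\<lambda>y. F y ** (mat 1 + \<delta> *\<^sub>R P y))"
  have P: "continuous_on UNIV P" "P y ** P y = P y" "mnorm (P y) \<le> L" for y
    unfolding P_def using E L
    by (auto intro: continuous_on_if_clopen[OF clop continuous_on_const] simp: mnorm_eq_0[THEN iffD2])
  have G: "G \<in> C0_GL" "C0_dist F G \<le> 2 * K * L * \<delta>"
    unfolding G_def by (rule C0_idempotent_perturbation[OF F K(2,3) P \<delta>])+
  have "2 * K * L * \<delta> = \<epsilon> / 2" using K L by (simp add: \<delta>_def)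
  then have dist: "C0_dist F G < \<epsilon>" using G(2) \<epsilon> by simp
  obtain q where q: "p = Suc q" using p(1) by (cases p) auto
  \<comment> \<open>The remaining \<open>p - 1\<close> steps of the period stay outside \<open>B\<close>.\<close>
  have "cocycle_nat T G q (T x) = cocycle_nat T F q (T x)"
  proof (rule cocycle_nat_cong)
    fix j assume j: "j < q"
    have "(T ^^ Suc j) x \<notin> B" using tower_baseD[OF B, of "Suc j"] j q by simp
    then have "(T ^^ j) (T x) \<notin> B" by (simp only: funpow_Suc_right o_apply) simp
    then show "G ((T ^^ j) (T x)) = F ((T ^^ j) (T x))" by (simp add: G_def P_def)
  qed
  then have "cocycle_nat T G p x = cocycle_nat T F q (T x) ** (F x ** (mat 1 + \<delta> *\<^sub>R E))"
    unfolding q cocycle_nat_Suc_right by (simp add: G_def P_def B(2))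
  also have "\<dots> = ?A ** (mat 1 + \<delta> *\<^sub>R E)"
    unfolding q cocycle_nat_Suc_right by (rule matrix_mul_assoc)
  finally have Gp: "cocycle_nat T G p x = ?A ** (mat 1 + \<delta> *\<^sub>R E)" .
  obtain k where "C < cond_number (matrix_power (?A ** (mat 1 + \<delta> *\<^sub>R E)) k)"
    using E(2)[OF \<delta>] unfolding unbounded_powers_def by blast
  then have "C < cond_number (cocycle_nat T G (k * p) x)"
    by (simp only: cocycle_nat_mult_period[OF p(2)] Gp)
  then show ?thesis using G(1) dist by blast
qed

text \<open>
  The points are treated one after the other. Exceeding \<open>C\<close> at a point is an open condition on the
  cocycle, so later perturbations can be taken small enough not to spoil earlier ones.
\<close>

lemma exceed_at_finitely_many_periodic_points:
  fixes F :: "'a \<Rightarrow> 'f::real_normed_field^'n^'n"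
  assumes zd: "zero_dimensional (euclidean :: 'a topology)"
    and destab: "\<And>A :: 'f^'n^'n. invertible A \<Longrightarrow> destabilizable A"
    and S: "finite S" "\<And>x. x \<in> S \<Longrightarrow> \<exists>p\<ge>1. (T ^^ p) x = x"
    and F: "F \<in> C0_GL" and \<epsilon>: "\<epsilon> > 0"
  shows "\<exists>G\<in>C0_GL. C0_dist F G < \<epsilon> \<and> (\<forall>x\<in>S. \<exists>n. C < cond_number (cocycle_nat T G n x))"
  using S \<epsilon>
proof (induction S arbitrary: \<epsilon> rule: finite_induct)
  case empty
  have "C0_dist F F = 0"
    using Metric_space.mdist_zero[OF Metric_space_C0[OF compact_space] F] .
  then show ?case using F empty by (intro bexI[of _ F]) simp_all
next
  case (insert x S)
  interpret Metric_space "C0_GL :: ('a \<Rightarrow> 'f^'n^'n) set" C0_dist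
    by (rule Metric_space_C0[OF compact_space])
  have "\<epsilon> / 2 > 0" using insert.prems by simp
  then obtain G where G: "G \<in> C0_GL" "C0_dist F G < \<epsilon> / 2"
    "\<forall>y\<in>S. \<exists>n. C < cond_number (cocycle_nat T G n y)"
    using insert.IH insert.prems(1) by blast
  have "\<forall>y\<in>S. \<exists>\<rho>>0. \<forall>H\<in>C0_GL. C0_dist H G < \<rho> \<longrightarrow> (\<exists>n. C < cond_number (cocycle_nat T H n y))"
  proof
    fix y assume "y \<in> S"
    then obtain n where "C < cond_number (cocycle_nat T G n y)" using G(3) by blast
    from stable_cond_number_at_point[OF G(1) this]
    show "\<exists>\<rho>>0. \<forall>H\<in>C0_GL. C0_dist H G < \<rho> \<longrightarrow> (\<exists>n. C < cond_number (cocycle_nat T H n y))"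
      by blast
  qed
  from bchoice[OF this] obtain \<rho> where \<rho>: "\<forall>y\<in>S. \<rho> y > 0 \<and>
    (\<forall>H\<in>C0_GL. C0_dist H G < \<rho> y \<longrightarrow> (\<exists>n. C < cond_number (cocycle_nat T H n y)))" ..
  \<comment> \<open>The term \<open>\<epsilon> / 2\<close> also covers an empty \<open>S\<close>.\<close>
  define r where "r = Min (insert (\<epsilon> / 2) (\<rho> ` S))"
  have fin: "finite (insert (\<epsilon> / 2) (\<rho> ` S))" using insert.hyps(1) by simp
  have r: "r \<le> \<epsilon> / 2" "\<And>y. y \<in> S \<Longrightarrow> r \<le> \<rho> y"
    unfolding r_def by (rule Min_le[OF fin], simp)+
  have r0: "r > 0" using insert.prems(2) \<rho> fin by (simp add: r_def)
  have per: "\<exists>p\<ge>1. (T ^^ p) x = x" using insert.prems(1) by simp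
  have "\<exists>H\<in>C0_GL. C0_dist G H < r \<and> (\<exists>n. C < cond_number (cocycle_nat T H n x))"
    by (rule exceed_at_periodic_point[OF zd _ G(1) r0 per]) (rule destab)
  then obtain H where H: "H \<in> C0_GL" "C0_dist G H < r" "\<exists>n. C < cond_number (cocycle_nat T H n x)"
    by blast
  have "C0_dist F H \<le> C0_dist F G + C0_dist G H" by (rule triangle[OF F G(1) H(1)])
  then have "C0_dist F H < \<epsilon>" using G(2) H(2) r(1) by linarith
  moreover have "\<exists>n. C < cond_number (cocycle_nat T H n y)" if y: "y \<in> S" for y
  proof -
    have "C0_dist H G < \<rho> y" using H(2) r(2)[OF y] by (simp add: commute)
    then show ?thesis using \<rho> y H(1) by blast
  qed
  ultimately show ?case using H(1,3) by blast
qed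

end

section \<open>Stretching along towers\<close>

text \<open>
  The power fixes every coordinate vector except the \<open>i\<close>-th, which it stretches by \<open>(1 + \<delta>)\<^sup>N\<close>.
\<close>

lemma cond_number_stretch_power:
  fixes \<delta> :: real and i :: "'n::finite"
  assumes d: "CARD('n) \<ge> 2" and \<delta>: "\<delta> > 0"
  defines "\<Delta> \<equiv> mat 1 + \<delta> *\<^sub>R row_projection i (axis i (1 :: 'f::real_normed_field))"
  shows "(1 + \<delta>) ^ N \<le> cond_number (matrix_power \<Delta> N)"
proof -
  have \<Delta>_axis: "\<Delta> *v axis k 1 = (if k = i then of_real (1 + \<delta>) else 1) *s axis k (1::'f)" for k
  proof -
    have "row_projection i (axis i (1::'f)) *v axis k 1 = (if k = i then axis k 1 else 0)"
      by (auto simp: vec_eq_iff mult_vec_axis) (auto simp: row_projection_def axis_def)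
    then show ?thesis
      by (auto simp: \<Delta>_def matrix_vector_mult_add_rdistrib scaleR_mult_vec vec_eq_iff axis_def
          scaleR_conv_of_real[where 'a = 'f])
  qed
  have "\<not> (\<forall>j. j = i)"
  proof
    assume "\<forall>j. j = i"
    then have "(UNIV :: 'n set) = {i}" by auto
    then have "CARD('n) = card {i}" by (rule arg_cong)
    then show False using d by simp
  qed
  then obtain j where j: "j \<noteq> i" by blast
  let ?M = "matrix_power \<Delta> N"
  have "invertible \<Delta>"
    unfolding \<Delta>_def
    by (rule idempotent_perturbation_inverse(1)[OF row_projection_idempotent \<delta>]) simp
  then have inv: "invertible ?M" by (rule invertible_matrix_power)
  have "?M *v axis i 1 = of_real (1 + \<delta>) ^ N *s axis i 1"
    by (rule matrix_power_eigenvector) (simp only: \<Delta>_axis if_True simp_thms)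
  also have "\<dots> = (1 + \<delta>) ^ N *\<^sub>R axis i 1"
    by (simp add: vec_eq_iff axis_def scaleR_conv_of_real[where 'a = 'f])
  finally have "norm (?M *v axis i 1) = (1 + \<delta>) ^ N"
    using \<delta> by (simp only: norm_scaleR norm_axis_field) simp
  moreover have "?M *v axis j 1 = 1 ^ N *s axis j 1"
    by (rule matrix_power_eigenvector) (simp only: \<Delta>_axis j if_False simp_thms)
  ultimately show ?thesis
    using cond_number_ge_ratio[OF inv, of "axis i 1" "axis j 1"] by (simp add: norm_axis_field)
qed

lemma mnorm_row_projection_axis:
  "mnorm (row_projection (i :: 'n::finite) (axis i (1 :: 'f::real_normed_field))) \<le> 1"
  unfolding mnorm_def
proof (rule onorm_bound)
  fix v :: "'f^'n"
  have "(\<Sum>j\<in>UNIV. axis i 1 $ j * v $ j) = (\<Sum>j\<in>(UNIV::'n set). if j = i then v $ i else 0)"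
    by (intro sum.cong) (auto simp: axis_def)
  then have "row_projection i (axis i 1) *v v = v $ i *s axis i 1"
    by (simp add: row_projection_mult_vec)
  also have "norm \<dots> = norm (v $ i) * norm (axis i (1::'f) :: 'f^'n)"
    by (simp add: norm_vec_def norm_mult L2_set_right_distrib)
  finally show "norm (row_projection i (axis i 1) *v v) \<le> 1 * norm v"
    by (simp add: norm_axis_field Finite_Cartesian_Product.norm_nth_le)
qed simp

context compact_homeomorphism
begin

text \<open>
  On level \<open>j\<close> above \<open>x\<close> the perturbation uses \<open>Q\<^sub>j = A\<^sub>j E A\<^sub>j\<^sup>-\<^sup>1\<close> with \<open>A\<^sub>j = F\<^sup>(\<^sup>j\<^sup>)(x)\<close>. Conjugating back to the base
  point makes the factors on successive levels accumulate to a power of \<open>1 + \<delta>E\<close>, and the bound on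
  the condition number of \<open>A\<^sub>j\<close> bounds \<open>Q\<^sub>j\<close>. The levels being clopen, \<open>P\<close> is continuous.
\<close>

lemma stretch_along_tower:
  fixes F :: "'a \<Rightarrow> 'f::real_normed_field^'n^'n"
  assumes F: "F \<in> C0_GL" and K: "\<And>x. mnorm (F x) \<le> K" "\<And>x. mnorm (matrix_inv (F x)) \<le> K"
    and U: "tower_base N U"
    and C: "C \<ge> 0" "\<And>x n. x \<in> U \<Longrightarrow> n < N \<Longrightarrow> cond_number (cocycle_nat T F n x) \<le> C"
    and E: "E ** E = E" "mnorm E \<le> 1" and \<delta>: "\<delta> > 0"
  shows "\<exists>G\<in>C0_GL. C0_dist F G \<le> 2 * K * C * \<delta> \<and>
    (\<forall>y. (\<forall>j<N. int_iter T (- int j) y \<notin> U) \<longrightarrow> G y = F y) \<and>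
    (\<forall>x\<in>U. cocycle_nat T G N x = cocycle_nat T F N x ** matrix_power (mat 1 + \<delta> *\<^sub>R E) N)"
proof -
  define Q where "Q j x = cocycle_nat T F j x ** E ** matrix_inv (cocycle_nat T F j x)" for j x
  define S where "S j = {y. int_iter T (- int j) y \<in> U}" for j
  define P where "P y = (\<Sum>j<N. if y \<in> S j then Q j (int_iter T (- int j) y) else 0)" for y
  define G where "G = (\<lambda>y. F y ** (mat 1 + \<delta> *\<^sub>R P y))"
  have inv: "invertible (cocycle_nat T F j x)" for j x
    by (rule invertible_cocycle_nat) (rule C0_GL_invertible[OF F])
  have P_level: "P ((T ^^ j) x) = Q j x" if x: "x \<in> U" "j < N" for j x
  proof -
    have cancel: "int_iter T (- int j) ((T ^^ j) x) = x"
      using int_iter_cancel[of "int j" x] by (simp add: int_iter_of_nat)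
    have "P ((T ^^ j) x) = (\<Sum>i<N. if i = j then Q j x else 0)"
      unfolding P_def
    proof (intro sum.cong refl)
      fix i assume "i \<in> {..<N}"
      then show "(if (T ^^ j) x \<in> S i then Q i (int_iter T (- int i) ((T ^^ j) x)) else 0) =
          (if i = j then Q j x else 0)"
        using tower_base_levels_disjoint[OF U x(1) _ x(2), of i] x(1) by (auto simp: S_def cancel)
    qed
    then show ?thesis using x(2) by simp
  qed
  have P_off: "P y = 0" if "\<And>j. j < N \<Longrightarrow> y \<notin> S j" for y
    unfolding P_def using that by (intro sum.neutral) simp
  have cases: "P y = 0 \<or> (\<exists>x j. x \<in> U \<and> j < N \<and> P y = Q j x)" for y
  proof (cases "\<forall>j<N. y \<notin> S j")
    case True
    then show ?thesis using P_off by blast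
  next
    case False
    then obtain j where j: "j < N" "int_iter T (- int j) y \<in> U" by (auto simp: S_def)
    have "(T ^^ j) (int_iter T (- int j) y) = y"
      by (simp add: int_iter_int_iter int_iter_0 flip: int_iter_of_nat)
    then have "P y = Q j (int_iter T (- int j) y)" using P_level[OF j(2,1)] by simp
    then show ?thesis using j by blast
  qed
  have Q_idem: "Q j x ** Q j x = Q j x" for j x
  proof -
    let ?A = "cocycle_nat T F j x"
    have "Q j x ** Q j x = ?A ** E ** (matrix_inv ?A ** ?A) ** E ** matrix_inv ?A"
      unfolding Q_def by (simp only: matrix_mul_assoc)
    also have "\<dots> = ?A ** (E ** E) ** matrix_inv ?A"
      by (simp only: matrix_inv_works(2)[OF inv] matrix_mul_rid matrix_mul_assoc)
    finally show ?thesis unfolding E Q_def .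
  qed
  have Q_norm: "mnorm (Q j x) \<le> C" if "x \<in> U" "j < N" for j x
  proof -
    let ?A = "cocycle_nat T F j x"
    have "mnorm (Q j x) \<le> mnorm ?A * 1 * mnorm (matrix_inv ?A)"
      unfolding Q_def by (intro mnorm_mult_mono E(2) order_refl)
    then show ?thesis using C(2)[OF that] by (simp add: cond_number_def)
  qed
  have P1: "P y ** P y = P y" for y using cases[of y] Q_idem by auto
  have P2: "mnorm (P y) \<le> C" for y
    using cases[of y] Q_norm C(1) mnorm_eq_0[of "0 :: 'f^'n^'n"] by auto
  have cont: "continuous_on UNIV (\<lambda>y. if y \<in> S j then Q j (int_iter T (- int j) y) else 0)" for j
  proof (rule continuous_on_if_clopen)
    show "open (S j)" "closed (S j)"
      unfolding S_def using U by (simp_all add: tower_base_def open_closed_preimage_int_iter)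
    have A: "continuous_on UNIV (\<lambda>y. cocycle_nat T F j (int_iter T (- int j) y))"
      by (rule continuous_on_compose2[OF continuous_on_cocycle_nat[OF continuous_T
              C0_GL_continuous[OF F]] continuous_int_iter]) simp
    show "continuous_on UNIV (\<lambda>y. Q j (int_iter T (- int j) y))"
      unfolding Q_def
      by (rule continuous_on_matrix_mult[OF continuous_on_matrix_mult[OF A continuous_on_const]
            continuous_on_matrix_inv[OF A inv]])
  qed
  have P3: "continuous_on UNIV P"
    unfolding P_def by (rule continuous_on_sum) (rule cont)
  have G: "G \<in> C0_GL" "C0_dist F G \<le> 2 * K * C * \<delta>"
    unfolding G_def by (rule C0_idempotent_perturbation[OF F K P3 P1 P2 \<delta>])+
  have off: "G y = F y" if "\<forall>j<N. int_iter T (- int j) y \<notin> U" for y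
    using P_off[of y] that by (simp add: G_def S_def)
  have tower: "cocycle_nat T G n x = cocycle_nat T F n x ** matrix_power (mat 1 + \<delta> *\<^sub>R E) n"
    if x: "x \<in> U" and n: "n \<le> N" for x n
    using n
  proof (induction n)
    case (Suc n)
    let ?A = "cocycle_nat T F n x" and ?D = "mat 1 + \<delta> *\<^sub>R E"
    have "(mat 1 + \<delta> *\<^sub>R Q n x) ** ?A = ?A + \<delta> *\<^sub>R (?A ** E ** (matrix_inv ?A ** ?A))"
      by (simp only: Q_def matrix_add_mult_right scaleR_matrix_mult matrix_mul_lid matrix_mul_assoc)
    also have "\<dots> = ?A ** ?D"
      by (simp only: matrix_inv_works(2)[OF inv] matrix_mul_rid matrix_add_ldistrib scaleR_matrix_mult)
    finally have conj: "(mat 1 + \<delta> *\<^sub>R Q n x) ** ?A = ?A ** ?D" .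
    have "cocycle_nat T G (Suc n) x =
        F ((T ^^ n) x) ** (mat 1 + \<delta> *\<^sub>R Q n x) ** (?A ** matrix_power ?D n)"
      using Suc P_level[OF x, of n] by (simp add: G_def)
    also have "\<dots> = F ((T ^^ n) x) ** ((mat 1 + \<delta> *\<^sub>R Q n x) ** ?A) ** matrix_power ?D n"
      by (simp only: matrix_mul_assoc)
    also have "\<dots> = F ((T ^^ n) x) ** (?A ** ?D) ** matrix_power ?D n" unfolding conj ..
    also have "\<dots> = cocycle_nat T F (Suc n) x ** matrix_power ?D (Suc n)"
      by (simp only: cocycle_nat.simps matrix_power.simps matrix_mul_assoc)
    finally show ?case .
  qed simp
  show ?thesis using G off tower by blast
qed

text \<open>
  The constants are chosen in this order: \<open>\<delta>\<close> small in terms of \<open>F\<close>, \<open>\<epsilon>\<close> and \<open>C\<close>; the height \<open>N\<close> of the towers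
  large in terms of \<open>\<delta>\<close>; a perturbation \<open>F'\<close> with products of condition number above \<open>2C\<close> at the points of period
  at most \<open>N\<close>; a number \<open>M\<close> of steps that suffices for this at all of them; the towers.
\<close>

lemma all_orbits_exceed_dense:
  fixes F :: "'a \<Rightarrow> 'f::real_normed_field^'n^'n"
  assumes zd: "zero_dimensional (euclidean :: 'a topology)"
    and fin: "\<And>p. p \<ge> 1 \<Longrightarrow> finite (periodic_points T p)"
    and destab: "\<And>A :: 'f^'n^'n. \<exists>p\<ge>1. periodic_points T p \<noteq> {} \<Longrightarrow> invertible A \<Longrightarrow> destabilizable A"
    and d: "CARD('n) \<ge> 2"
    and F: "F \<in> C0_GL" and \<epsilon>: "\<epsilon> > 0" and C: "C > 0"
  shows "\<exists>G\<in>C0_GL. C0_dist F G < \<epsilon> \<and> all_orbits_exceed C G"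
proof -
  interpret M: Metric_space "C0_GL :: ('a \<Rightarrow> 'f^'n^'n) set" C0_dist
    by (rule Metric_space_C0[OF compact_space])
  obtain K0 where K0: "K0 > 0" "\<And>x. mnorm (F x) \<le> K0" "\<And>x. mnorm (matrix_inv (F x)) \<le> K0"
    using C0_GL_bounded[OF compact_space F] by blast
  \<comment> \<open>\<open>F'\<close> depends on \<open>N\<close>, hence on \<open>\<delta>\<close>, so \<open>\<delta>\<close> needs a bound that holds for every \<open>F'\<close> at distance
    at most 1 from \<open>F\<close>.\<close>
  define K where "K = K0 + 1"
  have K: "K > 0" using K0(1) by (simp add: K_def)
  define \<delta> where "\<delta> = \<epsilon> / (8 * K * C)"
  have \<delta>: "\<delta> > 0" using \<epsilon> K C by (simp add: \<delta>_def)
  obtain N where N: "2 * C * C < (1 + \<delta>) ^ N"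
    using real_arch_pow[of "1 + \<delta>" "2 * C * C"] \<delta> by auto

  define S where "S = (\<Union>p\<in>{1..N}. periodic_points T p)"
  have finS: "finite S" using fin by (simp add: S_def)
  have perS: "\<exists>p\<ge>1. (T ^^ p) x = x" if "x \<in> S" for x
    using that by (auto simp: S_def periodic_points_def)
  have "\<exists>F'\<in>C0_GL. C0_dist F F' < min (\<epsilon> / 2) 1 \<and>
    (\<forall>x\<in>S. \<exists>n. 2 * C < cond_number (cocycle_nat T F' n x))"
  proof (cases "S = {}")
    case True
    then show ?thesis using F \<epsilon> by (intro bexI[of _ F]) simp_all
  next
    case False
    then have per: "\<exists>p\<ge>1. periodic_points T p \<noteq> {}" by (auto simp: S_def)
    show ?thesis
      by (rule exceed_at_finitely_many_periodic_points[OF zd _ finS perS F])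
        (use \<epsilon> destab[OF per] in auto)
  qed
  then obtain F' where F': "F' \<in> C0_GL" "C0_dist F F' < min (\<epsilon> / 2) 1"
    "\<forall>x\<in>S. \<exists>n. 2 * C < cond_number (cocycle_nat T F' n x)" by blast
  have KF': "mnorm (F' x) \<le> K" "mnorm (matrix_inv (F' x)) \<le> K" for x
  proof -
    have "mnorm (F' x - F x) \<le> 1" "mnorm (matrix_inv (F' x) - matrix_inv (F x)) \<le> 1"
      using mnorm_diff_le_C0_dist[OF compact_space F'(1) F, of x] F'(2) M.commute[of F F'] by linarith+
    then show "mnorm (F' x) \<le> K" "mnorm (matrix_inv (F' x)) \<le> K"
      using mnorm_triangle[of "F' x - F x" "F x"] K0(2)[of x]
        mnorm_triangle[of "matrix_inv (F' x) - matrix_inv (F x)" "matrix_inv (F x)"] K0(3)[of x]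
      by (simp_all add: K_def)
  qed
  let ?c = "\<lambda>n x. cond_number (cocycle_nat T F' n x)"

  from bchoice[OF F'(3)] obtain t where t: "\<forall>x\<in>S. 2 * C < ?c (t x) x" ..
  define M where "M = Max (insert N (t ` S))"
  have M: "N \<le> M" "\<And>x. x \<in> S \<Longrightarrow> t x \<le> M"
    using finS by (simp_all add: M_def)
  \<comment> \<open>The gap between \<open>C\<close> and \<open>2C\<close> leaves room for a clopen set: points outside \<open>V\<close> have all products up to
    \<open>M\<close> steps below \<open>2C\<close>, points of \<open>V\<close> have one above \<open>C\<close>.\<close>
  define O1 where "O1 = (\<Union>n\<in>{..M}. {y. C < ?c n y})"
  define O2 where "O2 = (\<Inter>n\<in>{..M}. {y. ?c n y < 2 * C})"
  note cont = continuous_cond_number_cocycle_nat[OF F'(1)]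
  have "open O1" unfolding O1_def
    by (intro open_UN ballI open_Collect_less continuous_on_const cont)
  moreover have "open O2" unfolding O2_def
    by (intro open_INT finite_atMost ballI open_Collect_less continuous_on_const cont)
  moreover have "O1 \<union> O2 = UNIV"
  proof -
    have "y \<in> O1 \<or> y \<in> O2" for y
    proof (cases "y \<in> O1")
      case False
      then have "?c n y \<le> C" if "n \<le> M" for n using that by (auto simp: O1_def not_less)
      then have "?c n y < 2 * C" if "n \<le> M" for n using that C by (smt (verit))
      then show ?thesis by (simp add: O2_def)
    qed simp
    then show ?thesis by auto
  qed
  ultimately obtain V where V: "open V" "closed V" "- O2 \<subseteq> V" "V \<subseteq> O1"
    by (rule clopen_separation[OF zd])

  \<comment> \<open>\<open>Y\<close> consists of the points from which a tower of height \<open>N\<close> stays off \<open>V\<close> and off its first \<open>M\<close>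
    images; the orbit of any other point enters \<open>V\<close>.\<close>
  define J where "J = {- int M..int N}"
  define Y where "Y = (\<Inter>k\<in>J. {y. int_iter T k y \<in> - V})"
  have Y: "open Y" "closed Y"
    unfolding Y_def J_def using V
    by (auto intro!: open_INT closed_INT open_closed_preimage_int_iter simp del: Compl_iff)
  have Y_V: "int_iter T k y \<notin> V" if "y \<in> Y" "- int M \<le> k" "k \<le> int N" for y k
    using that by (auto simp: Y_def J_def)
  have Y_O2: "y \<in> O2" if "y \<in> Y" for y
    using Y_V[OF that, of 0] V(3) by (auto simp: int_iter_0)
  have aper: "(T ^^ j) x \<noteq> x" if x: "x \<in> Y" and j: "0 < j" "j < N" for x j
  proof
    assume "(T ^^ j) x = x"
    then have "x \<in> S" using j by (auto simp: S_def periodic_points_def)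
    then have "2 * C < ?c (t x) x" "t x \<le> M" using t M(2) by auto
    moreover have "?c (t x) x < 2 * C" using Y_O2[OF x] M(2)[OF \<open>x \<in> S\<close>] by (simp add: O2_def)
    ultimately show False by simp
  qed
  obtain U where U: "U \<subseteq> Y" "tower_base N U" "\<And>x. x \<in> Y \<Longrightarrow> \<exists>m. int_iter T m x \<in> U"
    using ex_tower_base[OF zd Y, of N] aper by metis
  have cU: "?c n x \<le> 2 * C" if "x \<in> U" "n \<le> N" for x n
    using Y_O2[of x] U(1) that M(1) by (auto simp: O2_def intro!: less_imp_le)

  obtain i :: 'n where True by simp
  define E :: "'f^'n^'n" where "E = row_projection i (axis i 1)"
  have E: "E ** E = E" "mnorm E \<le> 1"
    unfolding E_def by (simp_all add: row_projection_idempotent mnorm_row_projection_axis)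
  have "\<exists>G\<in>C0_GL. C0_dist F' G \<le> 2 * K * (2 * C) * \<delta> \<and>
    (\<forall>y. (\<forall>j<N. int_iter T (- int j) y \<notin> U) \<longrightarrow> G y = F' y) \<and>
    (\<forall>x\<in>U. cocycle_nat T G N x = cocycle_nat T F' N x ** matrix_power (mat 1 + \<delta> *\<^sub>R E) N)"
    by (rule stretch_along_tower[OF F'(1) KF' U(2) _ _ E \<delta>]) (use C cU in auto)
  then obtain G where G: "G \<in> C0_GL" "C0_dist F' G \<le> 2 * K * (2 * C) * \<delta>"
    "\<And>y. (\<And>j. j < N \<Longrightarrow> int_iter T (- int j) y \<notin> U) \<Longrightarrow> G y = F' y"
    "\<And>x. x \<in> U \<Longrightarrow> cocycle_nat T G N x = cocycle_nat T F' N x ** matrix_power (mat 1 + \<delta> *\<^sub>R E) N"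
    by blast
  have "2 * K * (2 * C) * \<delta> = \<epsilon> / 2" using K C by (simp add: \<delta>_def)
  then have "C0_dist F G < \<epsilon>"
    using M.triangle[OF F F'(1) G(1)] G(2) F'(2) by linarith
  moreover have "all_orbits_exceed C G"
    unfolding all_orbits_exceed_def
  proof
    fix x
    show "\<exists>m n. C < cond_number (cocycle_nat T G n (int_iter T m x))"
    proof (cases "x \<in> Y")
      case False
      then obtain m where m: "int_iter T m x \<in> V" by (auto simp: Y_def)
      let ?y = "int_iter T m x"
      obtain n where n: "n \<le> M" "C < ?c n ?y" using m V(4) by (auto simp: O1_def)
      have "cocycle_nat T G n ?y = cocycle_nat T F' n ?y"
      proof (rule cocycle_nat_cong)
        fix j assume j: "j < n"
        \<comment> \<open>During the \<open>n \<le> M\<close> steps after visiting \<open>V\<close> the orbit meets no level of a tower.\<close>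
        show "G ((T ^^ j) ?y) = F' ((T ^^ j) ?y)"
        proof (rule G(3))
          fix k assume k: "k < N"
          let ?u = "int_iter T (- int k) ((T ^^ j) ?y)"
          have "int_iter T (int k - int j) ?u = ?y"
            by (simp add: int_iter_int_iter int_iter_0 flip: int_iter_of_nat)
          then show "?u \<notin> U" using Y_V[of ?u "int k - int j"] m U(1) j n(1) k by auto
        qed
      qed
      then show ?thesis using n(2) by metis
    next
      case True
      then obtain m where m: "int_iter T m x \<in> U" using U(3) by blast
      let ?u = "int_iter T m x"
      let ?A = "cocycle_nat T F' N ?u" and ?D = "matrix_power (mat 1 + \<delta> *\<^sub>R E) N"
      have A: "invertible ?A"
        by (rule invertible_cocycle_nat) (rule C0_GL_invertible[OF F'(1)])
      have D: "invertible ?D"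
        by (intro invertible_matrix_power idempotent_perturbation_inverse(1) E \<delta>)
      have "?D = matrix_inv ?A ** (?A ** ?D)"
        by (simp only: matrix_mul_assoc matrix_inv_works(2)[OF A] matrix_mul_lid)
      then have "cond_number ?D \<le> cond_number (matrix_inv ?A) * cond_number (?A ** ?D)"
        using cond_number_mult[OF invertible_matrix_inv[OF A] invertible_mult_field[OF A D]] by simp
      also have "\<dots> = ?c N ?u * cond_number (cocycle_nat T G N ?u)"
        by (simp only: cond_number_matrix_inv[OF A] G(4)[OF m])
      also have "\<dots> \<le> 2 * C * cond_number (cocycle_nat T G N ?u)"
        by (intro mult_right_mono cU[OF m] cond_number_nonneg order_refl)
      finally have "(1 + \<delta>) ^ N \<le> 2 * C * cond_number (cocycle_nat T G N ?u)"
        using cond_number_stretch_power[OF d \<delta>, of N i, where 'f = 'f] unfolding E_def by linarith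
      then have "2 * C * C < 2 * C * cond_number (cocycle_nat T G N ?u)" using N by linarith
      then have "C < cond_number (cocycle_nat T G N ?u)" using C by simp
      then show ?thesis by blast
    qed
  qed
  ultimately show ?thesis using G(1) by blast
qed

section \<open>Meagerness\<close>

lemma quasiconformal_orbits_meager:
  assumes zd: "zero_dimensional (euclidean :: 'a topology)"
    and fin: "\<And>p. p \<ge> 1 \<Longrightarrow> finite (periodic_points T p)"
    and destab: "\<And>A :: 'f::real_normed_field^'n^'n.
      \<exists>p\<ge>1. periodic_points T p \<noteq> {} \<Longrightarrow> invertible A \<Longrightarrow> destabilizable A"
    and d: "CARD('n) \<ge> 2"
  shows "meager_in C0_topology (quasiconformal_orbits T :: ('a \<Rightarrow> 'f^'n^'n) set)"
proof -
  interpret M: Metric_space "C0_GL :: ('a \<Rightarrow> 'f^'n^'n) set" C0_dist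
    by (rule Metric_space_C0[OF compact_space])
  \<comment> \<open>\<open>Suc k\<close> keeps the bound positive.\<close>
  define Z :: "nat \<Rightarrow> ('a \<Rightarrow> 'f^'n^'n) set" where
    "Z k = {F \<in> quasiconformal_orbits T. \<not> all_orbits_exceed (real (Suc k)) F}" for k
  have "nowhere_dense_in C0_topology (Z k)" for k
    unfolding nowhere_dense_in_def
  proof
    show "Z k \<subseteq> topspace C0_topology"
      by (auto simp: Z_def quasiconformal_orbits_def C0_topology_def)
    show "C0_topology interior_of (C0_topology closure_of Z k) = {}"
    proof (rule ccontr)
      assume "\<not> ?thesis"
      then obtain F where "F \<in> C0_topology interior_of (C0_topology closure_of Z k)" by blast
      then obtain \<epsilon> where F: "F \<in> C0_GL" and \<epsilon>: "\<epsilon> > 0"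
        and ball: "M.mball F \<epsilon> \<subseteq> C0_topology closure_of Z k"
        unfolding C0_topology_def M.in_interior_of_mball by blast
      have "\<exists>G\<in>C0_GL. C0_dist F G < \<epsilon> \<and> all_orbits_exceed (real (Suc k)) G"
        by (rule all_orbits_exceed_dense[OF zd _ _ d F \<epsilon>])
          (erule fin, rule destab, assumption+, simp)
      then obtain G where G: "G \<in> C0_GL" "C0_dist F G < \<epsilon>" "all_orbits_exceed (real (Suc k)) G"
        by blast
      obtain \<rho> where \<rho>: "\<rho> > 0"
        "\<And>H. H \<in> C0_GL \<Longrightarrow> C0_dist H G < \<rho> \<Longrightarrow> all_orbits_exceed (real (Suc k)) H"
        using stable_all_orbits_exceed[OF G(1,3)] by blast
      have "G \<in> M.mball F \<epsilon>" using F G by simp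
      then have "G \<in> M.mtopology closure_of Z k" using ball unfolding C0_topology_def by blast
      then obtain H where H: "H \<in> Z k" "H \<in> M.mball G \<rho>"
        unfolding M.metric_closure_of using \<rho>(1) by blast
      then have "all_orbits_exceed (real (Suc k)) H"
        using \<rho>(2)[of H] by (simp add: M.commute)
      then show False using H(1) by (simp add: Z_def)
    qed
  qed
  moreover have "quasiconformal_orbits T = (\<Union>k. Z k)"
  proof
    show "(\<Union>k. Z k) \<subseteq> quasiconformal_orbits T" by (auto simp: Z_def)
    show "quasiconformal_orbits T \<subseteq> (\<Union>k. Z k)"
    proof
      fix F :: "'a \<Rightarrow> 'f^'n^'n" assume F: "F \<in> quasiconformal_orbits T"
      then obtain x b where b: "\<And>n. cond_number (cocycle T F n x) \<le> b"
        and inv: "\<And>y. invertible (F y)"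
        by (auto simp: quasiconformal_orbits_def bdd_above_def C0_GL_def)
      obtain k where k: "b * b \<le> real k" using real_arch_simple by blast
      have "b \<ge> 0" using b[of 0] cond_number_nonneg[of "cocycle T F 0 x"] by linarith
      have "cond_number (cocycle_nat T F n (int_iter T m x)) \<le> real (Suc k)" for m n
      proof -
        have "cond_number (cocycle_nat T F n (int_iter T m x)) \<le> b * b"
          using cond_number_cocycle_shift[where F = F and n = n and m = m and x = x, OF bij_T inv]
            mult_mono[OF b b \<open>b \<ge> 0\<close> cond_number_nonneg, of "int n + m" m]
          by linarith
        then show ?thesis using k by simp
      qed
      then have "\<not> all_orbits_exceed (real (Suc k)) F"
        unfolding all_orbits_exceed_def by (meson not_le)
      then show "F \<in> (\<Union>k. Z k)" using F by (auto simp: Z_def)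
    qed
  qed
  ultimately show ?thesis unfolding meager_in_def by blast
qed

end

theorem theorem1p1:
  fixes T :: "'a::metric_space \<Rightarrow> 'a"
  assumes "compact (UNIV :: 'a set)"
    and "zero_dimensional (euclidean :: 'a topology)"
    and "homeomorphism UNIV UNIV T (inv T)"
    and "\<And>p. p \<ge> 1 \<Longrightarrow> finite (periodic_points T p)"
    and "CARD('n::finite) \<ge> 2"
  shows "meager_in C0_topology (quasiconformal_orbits T :: ('a \<Rightarrow> complex^'n^'n) set) \<and>
    (((\<exists>p\<ge>1. periodic_points T p \<noteq> {}) \<longrightarrow> CARD('n) \<ge> 3) \<longrightarrow>
      meager_in C0_topology (quasiconformal_orbits T :: ('a \<Rightarrow> real^'n^'n) set))"
proof (intro conjI impI)
  interpret compact_homeomorphism T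
    by (rule compact_homeomorphism.intro[OF assms(1,3)])
  show "meager_in C0_topology (quasiconformal_orbits T :: ('a \<Rightarrow> complex^'n^'n) set)"
    by (rule quasiconformal_orbits_meager[OF assms(2) _ _ assms(5)])
      (erule assms(4), erule destabilizable_complex[OF _ assms(5)])
  assume d: "(\<exists>p\<ge>1. periodic_points T p \<noteq> {}) \<longrightarrow> CARD('n) \<ge> 3"
  show "meager_in C0_topology (quasiconformal_orbits T :: ('a \<Rightarrow> real^'n^'n) set)"
    by (rule quasiconformal_orbits_meager[OF assms(2) _ _ assms(5)])
      (erule assms(4), erule destabilizable_real, erule d[rule_format])
qed

end
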